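(* Let $\mathscr{R}$ be a finite von Neumann algebra with a faithful normal tracial state $\tau$, and let $\Delta$ denote the Fuglede-Kadison determinant on $\mathscr{R}$ associated with $\tau$. Let $\Phi:\mathscr{R}\to\mathscr{R}$ be a trace-preserving unital positive map. Let $f$ be a continuous positive function defined on the interval $[a,b]\subseteq\mathbb{R}$ such that $\log f$ is convex (in other words, $f$ is log-convex). Then for every positive operator $A$ in $\mathscr{R}$ with spectrum contained in $[a,b]$, $$\Delta(f(\Phi(A)))\le\Delta(f(A)).$$
   Context: A unital positive map is a linear map sending positive operators to positive operators with $\Phi(I)=I$; it is trace-preserving if $\tau(\Phi(X))=\tau(X)$ for all $X\in\mathscr{R}$. "Positive function" means $f>0$ pointwise. $f(A)$ and $f(\Phi(A))$ are defined by continuous functional calculus (the spectrum of $\Phi(A)$ also lies in $[a,b]$, since $\Phi$ is unital and positive). "Regular" means invertible. Fuglede-Kadison determinant: for regular $A\in\mathscr{R}$, $\Delta(A)=\exp(\tau(\log (A^*A)^{1/2}))$. *)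

theory Defs
  imports "HOL-Analysis.Analysis" "HOL-Computational_Algebra.Polynomial"
begin

section \<open>Complex Hilbert spaces\<close>

text \<open>
  The class extends the real Hilbert spaces of the library by a compatible complex structure: the
  real scalar multiplication, the inner product and hence the norm are the ones induced by the
  complex ones. The complex inner product is linear in its \<^emph>\<open>first\<close> argument.
\<close>

class chilbert_space = real_inner + banach +
  fixes scaleC :: "complex \<Rightarrow> 'a \<Rightarrow> 'a"  (infixr "*\<^sub>C" 75)
    and cinner :: "'a \<Rightarrow> 'a \<Rightarrow> complex"
  assumes scaleC_add_right: "c *\<^sub>C (x + y) = c *\<^sub>C x + c *\<^sub>C y"
    and scaleC_add_left: "(c + d) *\<^sub>C x = c *\<^sub>C x + d *\<^sub>C x"
    and scaleC_scaleC: "c *\<^sub>C d *\<^sub>C x = (c * d) *\<^sub>C x"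
    and scaleR_scaleC: "r *\<^sub>R x = complex_of_real r *\<^sub>C x"
    and cinner_commute: "cinner x y = cnj (cinner y x)"
    and cinner_add_left: "cinner (x + y) z = cinner x z + cinner y z"
    and cinner_scaleC_left: "cinner (c *\<^sub>C x) y = c * cinner x y"
    and inner_eq_Re_cinner: "inner x y = Re (cinner x y)"

instantiation complex :: chilbert_space
begin

definition scaleC_complex :: "complex \<Rightarrow> complex \<Rightarrow> complex" where
  "scaleC_complex c x = c * x"

definition cinner_complex :: "complex \<Rightarrow> complex \<Rightarrow> complex" where
  "cinner_complex x y = x * cnj y"

instance
  by standard (auto simp: scaleC_complex_def cinner_complex_def algebra_simps scaleR_conv_of_real
      inner_complex_def)

end

lemma cinner_self: "cinner x x = complex_of_real ((norm x)\<^sup>2)"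
proof -
  have "Im (cinner x x) = 0"
    using arg_cong[OF cinner_commute[of x x], of Im] by simp
  then show ?thesis
    by (simp add: complex_eq_iff power2_norm_eq_inner inner_eq_Re_cinner del: of_real_power)
qed

lemma norm_scaleC: "norm (c *\<^sub>C x) = cmod c * norm x"
proof -
  have "cinner (c *\<^sub>C x) (c *\<^sub>C x) = c * cnj (c * cinner x x)"
    by (metis cinner_commute cinner_scaleC_left)
  also have "\<dots> = complex_of_real ((cmod c * norm x)\<^sup>2)"
    by (simp add: cinner_self complex_norm_square[symmetric] power_mult_distrib)
  finally have "(norm (c *\<^sub>C x))\<^sup>2 = (cmod c * norm x)\<^sup>2"
    unfolding cinner_self by (simp only: of_real_eq_iff)
  then show ?thesis
    by (simp add: power2_eq_iff_nonneg)
qed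

lemma bounded_linear_scaleC: "bounded_linear (\<lambda>x::'a::chilbert_space. c *\<^sub>C x)"
  by (rule bounded_linear_intro[where K = "cmod c"])
     (simp_all add: scaleC_add_right scaleR_scaleC scaleC_scaleC norm_scaleC mult.commute)


section \<open>Bounded operators\<close>

text \<open>
  Library bounded operators are real-linear; the operators on the complex Hilbert space are the
  complex-linear ones among them.
\<close>

type_synonym 'h operator = "'h \<Rightarrow>\<^sub>L 'h"

definition bounded_operators :: "'h::chilbert_space operator set" where
  "bounded_operators = {A :: 'h operator. \<forall>c x. A (c *\<^sub>C x) = c *\<^sub>C A x}"

definition scalar :: "complex \<Rightarrow> 'h::chilbert_space operator" where
  "scalar c = Blinfun (\<lambda>x. c *\<^sub>C x)"

lemma scalar_apply [simp]: "scalar c x = c *\<^sub>C x"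
  unfolding scalar_def by (simp add: bounded_linear_Blinfun_apply bounded_linear_scaleC)

definition adj :: "'h::chilbert_space operator \<Rightarrow> 'h operator" where
  "adj A = (THE B :: 'h operator. \<forall>x y. cinner (A x) y = cinner x (B y))"

definition self_adjoint :: "'h::chilbert_space operator \<Rightarrow> bool" where
  "self_adjoint A \<longleftrightarrow> A \<in> bounded_operators \<and> (\<forall>x y. cinner (A x) y = cinner x (A y))"

definition positive_op :: "'h::chilbert_space operator \<Rightarrow> bool" where
  "positive_op A \<longleftrightarrow> A \<in> bounded_operators \<and> (\<forall>x. cinner (A x) x \<in> \<real>\<^sub>\<ge>\<^sub>0)"

definition op_le :: "'h::chilbert_space operator \<Rightarrow> 'h operator \<Rightarrow> bool"  (infix "\<preceq>" 50) where
  "A \<preceq> B \<longleftrightarrow> positive_op (B - A)"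

definition invertible_op :: "'h::chilbert_space operator \<Rightarrow> bool" where
  "invertible_op A \<longleftrightarrow>
    (\<exists>B\<in>bounded_operators. A o\<^sub>L B = id_blinfun \<and> B o\<^sub>L A = id_blinfun)"

definition spectrum :: "'h::chilbert_space operator \<Rightarrow> complex set" where
  "spectrum A = {c. \<not> invertible_op (A - scalar c)}"


section \<open>Continuous functional calculus of self-adjoint operators\<close>

definition poly_op :: "real poly \<Rightarrow> 'h::chilbert_space operator \<Rightarrow> 'h operator" where
  "poly_op p A = (\<Sum>i\<le>degree p. coeff p i *\<^sub>R (((o\<^sub>L) A ^^ i) id_blinfun))"

text \<open>
  For a self-adjoint operator \<open>A\<close> and a real function \<open>f\<close> that is continuous on the (real)
  spectrum of \<open>A\<close>, \<open>f(A)\<close> is the norm limit of \<open>p\<^sub>n(A)\<close> for any polynomials \<open>p\<^sub>n\<close> converging to \<open>f\<close>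
  uniformly on the spectrum. Such polynomials exist by the Weierstrass theorem, and the limit does
  not depend on their choice. For other \<open>A\<close> or \<open>f\<close> the value is meaningless.
\<close>

definition cfc :: "(real \<Rightarrow> real) \<Rightarrow> 'h::chilbert_space operator \<Rightarrow> 'h operator" where
  "cfc f A = (THE T :: 'h operator. \<forall>p. uniform_limit {t. complex_of_real t \<in> spectrum A}
                            (\<lambda>n t. poly (p n) t) f sequentially
                        \<longrightarrow> (\<lambda>n. poly_op (p n) A) \<longlonglongrightarrow> T)"


section \<open>Finite von Neumann algebras and tracial states\<close>

text \<open>
  A unital *-subalgebra of the bounded operators that is closed in the strong operator topology.
\<close>

definition von_neumann_algebra :: "'h::chilbert_space operator set \<Rightarrow> bool" where
  "von_neumann_algebra R \<longleftrightarrow>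
     R \<subseteq> bounded_operators \<and>
     id_blinfun \<in> R \<and>
     (\<forall>A\<in>R. \<forall>B\<in>R. A + B \<in> R) \<and>
     (\<forall>c. \<forall>A\<in>R. scalar c o\<^sub>L A \<in> R) \<and>
     (\<forall>A\<in>R. \<forall>B\<in>R. A o\<^sub>L B \<in> R) \<and>
     (\<forall>A\<in>R. adj A \<in> R) \<and>
     closedin strong_operator_topology R"

text \<open>
  Finiteness: the identity is not equivalent to a proper subprojection, i.e. every isometry in the
  algebra is unitary.
\<close>

definition finite_von_neumann_algebra :: "'h::chilbert_space operator set \<Rightarrow> bool" where
  "finite_von_neumann_algebra R \<longleftrightarrow>
     von_neumann_algebra R \<and>
     (\<forall>V\<in>R. adj V o\<^sub>L V = id_blinfun \<longrightarrow> V o\<^sub>L adj V = id_blinfun)"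

definition linear_on_algebra ::
    "'h::chilbert_space operator set \<Rightarrow> ('h operator \<Rightarrow> 'b::ab_group_add) \<Rightarrow> (complex \<Rightarrow> 'b \<Rightarrow> 'b) \<Rightarrow> bool"
  where
  "linear_on_algebra R F smul \<longleftrightarrow>
     (\<forall>A\<in>R. \<forall>B\<in>R. F (A + B) = F A + F B) \<and>
     (\<forall>c. \<forall>A\<in>R. F (scalar c o\<^sub>L A) = smul c (F A))"

definition state :: "'h::chilbert_space operator set \<Rightarrow> ('h operator \<Rightarrow> complex) \<Rightarrow> bool" where
  "state R \<tau> \<longleftrightarrow>
     linear_on_algebra R \<tau> (*) \<and>
     (\<forall>A\<in>R. positive_op A \<longrightarrow> \<tau> A \<in> \<real>\<^sub>\<ge>\<^sub>0) \<and>
     \<tau> id_blinfun = 1"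

definition tracial :: "'h::chilbert_space operator set \<Rightarrow> ('h operator \<Rightarrow> complex) \<Rightarrow> bool" where
  "tracial R \<tau> \<longleftrightarrow> (\<forall>A\<in>R. \<forall>B\<in>R. \<tau> (A o\<^sub>L B) = \<tau> (B o\<^sub>L A))"

definition faithful :: "'h::chilbert_space operator set \<Rightarrow> ('h operator \<Rightarrow> complex) \<Rightarrow> bool" where
  "faithful R \<tau> \<longleftrightarrow> (\<forall>A\<in>R. positive_op A \<longrightarrow> \<tau> A = 0 \<longrightarrow> A = 0)"

text \<open>
  Normality: \<open>\<tau>\<close> preserves the suprema of upward directed sets (equivalently, of increasing nets) of
  self-adjoint operators. Values on self-adjoint operators are real.
\<close>

definition normal :: "'h::chilbert_space operator set \<Rightarrow> ('h operator \<Rightarrow> complex) \<Rightarrow> bool" where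
  "normal R \<tau> \<longleftrightarrow>
     (\<forall>D S. D \<noteq> {} \<longrightarrow> D \<subseteq> {X \<in> R. self_adjoint X} \<longrightarrow>
        (\<forall>X\<in>D. \<forall>Y\<in>D. \<exists>Z\<in>D. X \<preceq> Z \<and> Y \<preceq> Z) \<longrightarrow>
        S \<in> R \<longrightarrow> self_adjoint S \<longrightarrow> (\<forall>X\<in>D. X \<preceq> S) \<longrightarrow>
        (\<forall>U\<in>R. self_adjoint U \<longrightarrow> (\<forall>X\<in>D. X \<preceq> U) \<longrightarrow> S \<preceq> U) \<longrightarrow>
        Re (\<tau> S) = (SUP X\<in>D. Re (\<tau> X)))"

definition faithful_normal_tracial_state ::
    "'h::chilbert_space operator set \<Rightarrow> ('h operator \<Rightarrow> complex) \<Rightarrow> bool" where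
  "faithful_normal_tracial_state R \<tau> \<longleftrightarrow> state R \<tau> \<and> tracial R \<tau> \<and> faithful R \<tau> \<and> normal R \<tau>"

text \<open>Only invertible \<open>A\<close> are meaningful arguments; then \<open>\<tau>(log |A|)\<close> is real.\<close>

definition fuglede_kadison_det ::
    "('h::chilbert_space operator \<Rightarrow> complex) \<Rightarrow> 'h operator \<Rightarrow> real" where
  "fuglede_kadison_det \<tau> A = exp (Re (\<tau> (cfc ln (cfc sqrt (adj A o\<^sub>L A)))))"

definition unital_positive_map ::
    "'h::chilbert_space operator set \<Rightarrow> ('h operator \<Rightarrow> 'h operator) \<Rightarrow> bool" where
  "unital_positive_map R \<Phi> \<longleftrightarrow>
     \<Phi> ` R \<subseteq> R \<and>
     linear_on_algebra R \<Phi> (\<lambda>c B. scalar c o\<^sub>L B) \<and>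
     (\<forall>A\<in>R. positive_op A \<longrightarrow> positive_op (\<Phi> A)) \<and>
     \<Phi> id_blinfun = id_blinfun"

definition trace_preserving ::
    "'h::chilbert_space operator set \<Rightarrow> ('h operator \<Rightarrow> complex) \<Rightarrow> ('h operator \<Rightarrow> 'h operator) \<Rightarrow> bool"
  where
  "trace_preserving R \<tau> \<Phi> \<longleftrightarrow> (\<forall>X\<in>R. \<tau> (\<Phi> X) = \<tau> X)"

end

(*
Put g = log f, B = \<Phi>(A) and G = \<Phi>(g(A)). Since log \<Delta>(f(X)) = \<tau>(g(X)), and \<tau>(G) = \<tau>(g(A)), it suffices
that \<tau>(g(B)) \<le> \<tau>(G). Every affine l \<le> g on [a,b] gives l(A) \<le> g(A), hence l(B) \<le> G. By compactness
finitely many such l_i come within \<epsilon> of g, and a continuous partition of unity q_i that charges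
l_i only where it is close to g yields
  \<tau>(G) = \<Sum> \<tau>(q_i(B) G) \<ge> \<Sum> \<tau>(q_i(B) l_i(B)) \<ge> \<tau>(g(B)) - \<epsilon>,
where the trace property makes \<tau>(q(B) X) \<ge> 0 for q \<ge> 0 and X \<ge> 0.
*)
theory Submission
  imports Defs "HOL-Computational_Algebra.Fundamental_Theorem_Algebra"
begin

section \<open>Operators on a complex Hilbert space\<close>

text \<open>For merely convex g the operator inequality g(B) \<le> G can fail, and G need not
  commute with B. Multiplying G - l_i(B) by q_i(B) therefore leaves a product with no sign and in
  general not even self-adjoint; only the trace restores a sign, by moving one square root of q_i(B)
  to the other side. Affine functions are the right test functions because a unital linear map
  carries them through: \<Phi>(l(A)) = l(\<Phi>(A)). The slack \<epsilon> answers the endpoints of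
  [a,b], where a convex function may have a vertical tangent and hence no supporting line; it also
  makes the compactness argument possible.

  Much of the work is the functional calculus. \<open>cfc\<close> is a definite description, so it
  yields nothing until ||p(A)|| is bounded by the supremum of |p| over the spectrum. That bound
  joins two facts: a real polynomial without zeros on the spectrum gives an invertible p(A), and
  ||T||^2 - T^2 is never invertible for self-adjoint nonzero T.\<close>

lemma cinner_scaleC_right: "cinner x (c *\<^sub>C y) = cnj c * cinner x y"
  by (metis cinner_commute cinner_scaleC_left complex_cnj_mult)

lemma cinner_add_right: "cinner x (y + z) = cinner x y + cinner x z"
  by (metis cinner_add_left cinner_commute complex_cnj_add)

lemma Im_cinner: "Im (cinner x y) = inner x (\<i> *\<^sub>C y)"
  by (simp add: inner_eq_Re_cinner cinner_scaleC_right)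

lemma bounded_operators_iff: "A \<in> bounded_operators \<longleftrightarrow> (\<forall>c x. A (c *\<^sub>C x) = c *\<^sub>C A x)"
  by (simp add: bounded_operators_def)

lemma scaleC_scaleR_commute: "c *\<^sub>C (r *\<^sub>R x) = r *\<^sub>R (c *\<^sub>C (x::'h::chilbert_space))"
  by (simp add: scaleR_scaleC scaleC_scaleC mult.commute)

lemma scaleC_diff_right: "c *\<^sub>C (x - y) = c *\<^sub>C x - c *\<^sub>C (y::'h::chilbert_space)"
  using bounded_linear_scaleC[of c, THEN bounded_linear.linear] by (rule linear_diff)

lemma scalar_of_real: "scalar (complex_of_real r) = r *\<^sub>R id_blinfun"
  by (rule blinfun_eqI) (simp add: scaleR_scaleC blinfun.scaleR_left)

lemma scalar_of_real_compose: "scalar (complex_of_real r) o\<^sub>L A = r *\<^sub>R A"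
  by (rule blinfun_eqI) (simp add: scaleR_scaleC blinfun.scaleR_left)

lemma bounded_operators_id: "id_blinfun \<in> bounded_operators"
  by (simp add: bounded_operators_iff)

lemma bounded_operators_add:
  "A \<in> bounded_operators \<Longrightarrow> B \<in> bounded_operators \<Longrightarrow> A + B \<in> bounded_operators"
  by (simp add: bounded_operators_iff blinfun.add_left scaleC_add_right)

lemma bounded_operators_diff:
  "A \<in> bounded_operators \<Longrightarrow> B \<in> bounded_operators \<Longrightarrow> A - B \<in> bounded_operators"
  by (simp add: bounded_operators_iff blinfun.diff_left scaleC_diff_right)

lemma bounded_operators_scaleR: "A \<in> bounded_operators \<Longrightarrow> r *\<^sub>R A \<in> bounded_operators"
  by (simp add: bounded_operators_iff blinfun.scaleR_left scaleC_scaleR_commute)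

lemma bounded_operators_compose:
  "A \<in> bounded_operators \<Longrightarrow> B \<in> bounded_operators \<Longrightarrow> A o\<^sub>L B \<in> bounded_operators"
  by (simp add: bounded_operators_iff)

lemma bounded_operators_LIMSEQ:
  assumes "\<And>n. X n \<in> bounded_operators" and "X \<longlonglongrightarrow> T"
  shows "T \<in> bounded_operators"
  unfolding bounded_operators_iff
proof (intro allI)
  fix c x
  have "(\<lambda>n. X n (c *\<^sub>C x)) \<longlonglongrightarrow> T (c *\<^sub>C x)"
    by (intro tendsto_intros assms)
  moreover have "(\<lambda>n. c *\<^sub>C X n x) \<longlonglongrightarrow> c *\<^sub>C T x"
    by (intro bounded_linear.tendsto[OF bounded_linear_scaleC] tendsto_intros assms)
  moreover have "X n (c *\<^sub>C x) = c *\<^sub>C X n x" for n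
    using assms(1) by (simp add: bounded_operators_iff)
  ultimately show "T (c *\<^sub>C x) = c *\<^sub>C T x"
    using LIMSEQ_unique by simp
qed

text \<open>Complex linearity supplies the imaginary part: \<open>Im (cinner x y)\<close> is
  \<open>inner x (\<i> *\<^sub>C y)\<close>, so the real identity at \<open>\<i> *\<^sub>C y\<close>
  is the imaginary identity at \<open>y\<close>. This lets later estimates use the real inner
  product alone.\<close>

lemma self_adjoint_iff:
  "self_adjoint A \<longleftrightarrow> A \<in> bounded_operators \<and> (\<forall>x y. inner (A x) y = inner x (A y))"
proof
  assume "self_adjoint A"
  then show "A \<in> bounded_operators \<and> (\<forall>x y. inner (A x) y = inner x (A y))"
    by (simp add: self_adjoint_def inner_eq_Re_cinner)
next
  assume A: "A \<in> bounded_operators \<and> (\<forall>x y. inner (A x) y = inner x (A y))"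
  then have "A (\<i> *\<^sub>C y) = \<i> *\<^sub>C A y" for y
    by (simp add: bounded_operators_iff)
  then have "cinner (A x) y = cinner x (A y)" for x y
    using A by (simp add: complex_eq_iff Im_cinner flip: inner_eq_Re_cinner)
  with A show "self_adjoint A"
    by (simp add: self_adjoint_def)
qed

lemma self_adjointD: "self_adjoint A \<Longrightarrow> inner (A x) y = inner x (A y)"
  by (simp add: self_adjoint_iff)

lemma self_adjoint_bounded: "self_adjoint A \<Longrightarrow> A \<in> bounded_operators"
  by (simp add: self_adjoint_iff)

lemma self_adjoint_id: "self_adjoint id_blinfun"
  by (simp add: self_adjoint_iff bounded_operators_id)

lemma self_adjoint_add: "self_adjoint A \<Longrightarrow> self_adjoint B \<Longrightarrow> self_adjoint (A + B)"
  by (simp add: self_adjoint_iff bounded_operators_add blinfun.add_left inner_add_left inner_add_right)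

lemma self_adjoint_scaleR: "self_adjoint A \<Longrightarrow> self_adjoint (r *\<^sub>R A)"
  by (simp add: self_adjoint_iff bounded_operators_scaleR blinfun.scaleR_left)

lemma self_adjoint_compose:
  assumes A: "self_adjoint A" and B: "self_adjoint B" and AB: "A o\<^sub>L B = B o\<^sub>L A"
  shows "self_adjoint (A o\<^sub>L B)"
proof -
  have "inner ((A o\<^sub>L B) x) y = inner x ((A o\<^sub>L B) y)" for x y
  proof -
    have "inner ((A o\<^sub>L B) x) y = inner x ((B o\<^sub>L A) y)"
      using self_adjointD[OF A, of "B x" y] self_adjointD[OF B, of x "A y"] by simp
    then show ?thesis
      by (simp only: AB)
  qed
  moreover have "A o\<^sub>L B \<in> bounded_operators"
    by (intro bounded_operators_compose self_adjoint_bounded A B)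
  ultimately show ?thesis
    unfolding self_adjoint_iff by blast
qed

lemma self_adjoint_LIMSEQ:
  assumes "\<And>n. self_adjoint (X n)" and "X \<longlonglongrightarrow> T"
  shows "self_adjoint T"
  unfolding self_adjoint_iff
proof (intro conjI allI)
  show "T \<in> bounded_operators"
    using self_adjoint_bounded[OF assms(1)] assms(2) by (rule bounded_operators_LIMSEQ)
  fix x y
  have "(\<lambda>n. inner (X n x) y) \<longlonglongrightarrow> inner (T x) y" "(\<lambda>n. inner x (X n y)) \<longlonglongrightarrow> inner x (T y)"
    by (intro tendsto_intros assms)+
  then show "inner (T x) y = inner x (T y)"
    using LIMSEQ_unique by (simp add: self_adjointD[OF assms(1)])
qed

text \<open>Evaluates the definite description in \<open>adj\<close> at the operators f(X) to which
  the determinant is applied: such an operator is its own witness.\<close>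

lemma adj_self_adjoint: "self_adjoint A \<Longrightarrow> adj A = A"
  unfolding adj_def
proof (rule the_equality)
  assume A: "self_adjoint A"
  then show "\<forall>x y. cinner (A x) y = cinner x (A y)"
    by (simp add: self_adjoint_def)
  fix B :: "'a operator" assume "\<forall>x y. cinner (A x) y = cinner x (B y)"
  then have "inner x (B y) = inner x (A y)" for x y
    using A by (simp add: self_adjoint_def inner_eq_Re_cinner)
  then show "B = A"
    by (intro blinfun_eqI) (metis inner_diff_right inner_eq_zero_iff right_minus_eq)
qed

text \<open>Self-adjointness follows by polarization, using that the space is complex.\<close>

lemma positive_op_iff: "positive_op A \<longleftrightarrow> self_adjoint A \<and> (\<forall>x. inner (A x) x \<ge> 0)"
proof
  assume A: "positive_op A"
  then have lin: "A (c *\<^sub>C x) = c *\<^sub>C A x" for c x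
    by (simp add: positive_op_def bounded_operators_iff)
  have pos: "cinner (A x) x \<in> \<real>\<^sub>\<ge>\<^sub>0" for x
    using A by (simp add: positive_op_def)
  then have im: "Im (cinner (A x) x) = 0" for x
    using complex_nonneg_Reals_iff by blast
  have "cinner (A x) y = cinner x (A y)" for x y
  proof -
    have "Im (cinner (A x) y) + Im (cinner (A y) x) = 0"
      using im[of "x + y"] im[of x] im[of y]
      by (simp add: blinfun.add_right cinner_add_left cinner_add_right)
    moreover have "Re (cinner (A y) x) - Re (cinner (A x) y) = 0"
      using im[of "x + \<i> *\<^sub>C y"] im[of x] im[of "\<i> *\<^sub>C y"]
      by (simp add: blinfun.add_right cinner_add_left cinner_add_right lin cinner_scaleC_left
          cinner_scaleC_right)
    ultimately show ?thesis
      by (subst cinner_commute[of x]) (simp add: complex_eq_iff)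
  qed
  then have "self_adjoint A"
    using A by (simp add: self_adjoint_def positive_op_def)
  moreover have "inner (A x) x \<ge> 0" for x
    using pos[of x] by (simp add: inner_eq_Re_cinner complex_nonneg_Reals_iff)
  ultimately show "self_adjoint A \<and> (\<forall>x. inner (A x) x \<ge> 0)"
    by simp
next
  assume A: "self_adjoint A \<and> (\<forall>x. inner (A x) x \<ge> 0)"
  then have "cinner (A x) x = cnj (cinner (A x) x)" for x
    by (metis cinner_commute self_adjoint_def)
  then have "Im (cinner (A x) x) = 0" for x
    by (metis Reals_cnj_iff complex_is_Real_iff)
  then show "positive_op A"
    using A by (simp add: positive_op_def complex_nonneg_Reals_iff self_adjoint_bounded
        flip: inner_eq_Re_cinner)
qed

lemma positive_op_square: "self_adjoint A \<Longrightarrow> positive_op (A o\<^sub>L A)"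
  by (simp add: positive_op_iff self_adjoint_compose self_adjointD[of A "A _"])

lemma positive_op_conjugate:
  assumes "positive_op A" "self_adjoint S"
  shows "positive_op (S o\<^sub>L A o\<^sub>L S)"
  unfolding positive_op_iff
proof
  show "self_adjoint (S o\<^sub>L A o\<^sub>L S)"
    unfolding self_adjoint_iff using assms
    by (simp add: positive_op_iff bounded_operators_compose self_adjoint_bounded self_adjointD[of S]
        self_adjointD[of A])
  show "\<forall>x. inner ((S o\<^sub>L A o\<^sub>L S) x) x \<ge> 0"
    using assms by (simp add: positive_op_iff self_adjointD[of S "A _"])
qed

section \<open>Invertibility\<close>

lemma invertible_op_compose:
  assumes "invertible_op A" "invertible_op B"
  shows "invertible_op (A o\<^sub>L B)"
proof -
  obtain A' B' where A': "A' \<in> bounded_operators" "A o\<^sub>L A' = id_blinfun" "A' o\<^sub>L A = id_blinfun"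
    and B': "B' \<in> bounded_operators" "B o\<^sub>L B' = id_blinfun" "B' o\<^sub>L B = id_blinfun"
    using assms by (auto simp: invertible_op_def)
  have "A (A' x) = x" "A' (A x) = x" "B (B' x) = x" "B' (B x) = x" for x
    using A' B' by (metis blinfun_apply_blinfun_compose blinfun_apply_id_blinfun id_apply)+
  then show ?thesis
    unfolding invertible_op_def using A' B'
    by (intro bexI[of _ "B' o\<^sub>L A'"] conjI blinfun_eqI) (auto intro: bounded_operators_compose)
qed

text \<open>The Lax-Milgram argument: solving T x = y means finding a fixed point of x - t (T x -
  y), a contraction for small t. Coercivity also bounds the inverse, by 1/c.\<close>

lemma coercive_invertible:
  fixes T :: "'h::chilbert_space operator"
  assumes T: "T \<in> bounded_operators" and c: "c > 0"
    and coercive: "\<And>x. inner (T x) x \<ge> c * (norm x)\<^sup>2"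
  shows "invertible_op T"
proof -
  \<comment> \<open>Adding \<open>c\<close> to the norm gives both M > 0 and c \<le> M at once, so
    the contraction factor below is a real number less than 1.\<close>
  define M where "M = norm T + c"
  have M: "M > 0" "norm T \<le> M" "c \<le> M"
    using c by (auto simp: M_def add_nonneg_pos)
  \<comment> \<open>The minimizer of 1 - 2 t c + t^2 M^2, the bound for the squared contraction
    factor; the minimum is 1 - c^2 / M^2 = k^2.\<close>
  define t where "t = c / M\<^sup>2"
  have t: "t > 0" using c M by (simp add: t_def)
  define k where "k = sqrt (1 - c\<^sup>2 / M\<^sup>2)"
  have le1: "c\<^sup>2 / M\<^sup>2 \<le> 1" "c\<^sup>2 / M\<^sup>2 > 0"
    using M c by (auto simp: power_mono)
  have contr: "norm (x - t *\<^sub>R T x) \<le> k * norm x" for x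
  proof -
    have "norm (T x) \<le> M * norm x"
      using norm_blinfun[of T x] M by (meson mult_right_mono norm_ge_zero order_trans)
    then have "(norm (T x))\<^sup>2 \<le> M\<^sup>2 * (norm x)\<^sup>2"
      by (metis norm_ge_zero power_mono power_mult_distrib)
    then have "t\<^sup>2 * (norm (T x))\<^sup>2 \<le> t\<^sup>2 * (M\<^sup>2 * (norm x)\<^sup>2)"
      by (rule mult_left_mono) simp
    moreover have "t * inner (T x) x \<ge> t * (c * (norm x)\<^sup>2)"
      using t coercive by (intro mult_left_mono) auto
    moreover have "(norm (x - t *\<^sub>R T x))\<^sup>2 = (norm x)\<^sup>2 - 2 * (t * inner (T x) x) + t\<^sup>2 * (norm (T x))\<^sup>2"
      unfolding power2_norm_eq_inner
      by (simp add: inner_diff_left inner_diff_right inner_commute power2_eq_square algebra_simps)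
    ultimately have "(norm (x - t *\<^sub>R T x))\<^sup>2
        \<le> (norm x)\<^sup>2 - 2 * (t * (c * (norm x)\<^sup>2)) + t\<^sup>2 * (M\<^sup>2 * (norm x)\<^sup>2)"
      by linarith
    also have "\<dots> = (1 - 2 * (t * c) + t\<^sup>2 * M\<^sup>2) * (norm x)\<^sup>2"
      by (simp add: algebra_simps)
    also have "1 - 2 * (t * c) + t\<^sup>2 * M\<^sup>2 = 1 - c\<^sup>2 / M\<^sup>2"
      using M by (simp add: t_def field_simps power2_eq_square)
    also have "\<dots> = k\<^sup>2"
      using le1 by (simp add: k_def)
    also have "k\<^sup>2 * (norm x)\<^sup>2 = (k * norm x)\<^sup>2"
      by (simp add: power_mult_distrib)
    finally show ?thesis
      using le1 by (auto intro: power2_le_imp_le simp: k_def)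
  qed
  have "\<exists>x. T x = y" for y
  proof -
    have "\<exists>!x. x - t *\<^sub>R T x + t *\<^sub>R y = x"
    proof (rule banach_fix_type)
      show "0 \<le> k" "k < 1"
        using le1 by (auto simp: k_def)
      have "x - t *\<^sub>R T x + t *\<^sub>R y - (z - t *\<^sub>R T z + t *\<^sub>R y) = (x - z) - t *\<^sub>R T (x - z)" for x z
        by (simp add: blinfun.diff_right algebra_simps)
      then show "\<forall>x z. dist (x - t *\<^sub>R T x + t *\<^sub>R y) (z - t *\<^sub>R T z + t *\<^sub>R y) \<le> k * dist x z"
        unfolding dist_norm by (simp only: contr simp_thms)
    qed
    then obtain x where "t *\<^sub>R T x = t *\<^sub>R y"
      by (auto simp: algebra_simps)
    with t show ?thesis by auto
  qed
  then obtain g where g: "T (g y) = y" for y by metis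
  have below: "c * norm x \<le> norm (T x)" for x
  proof -
    have "c * norm x * norm x \<le> norm (T x) * norm x"
      using coercive[of x] norm_cauchy_schwarz[of "T x" x] by (simp add: power2_eq_square)
    then show ?thesis
      by (cases "x = 0") (auto simp: mult_le_cancel_right)
  qed
  have inj: "x = y" if "T x = T y" for x y
    using below[of "x - y"] that c by (simp add: blinfun.diff_right mult_le_0_iff)
  have "bounded_linear g"
  proof (rule bounded_linear_intro[where K = "1 / c"])
    show "g (x + y) = g x + g y" for x y
      by (rule inj) (simp add: g blinfun.add_right)
    show "g (r *\<^sub>R x) = r *\<^sub>R g x" for r x
      by (rule inj) (simp add: g blinfun.scaleR_right)
    show "norm (g x) \<le> norm x * (1 / c)" for x
      using below[of "g x"] c by (simp add: g field_simps)
  qed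
  then have G: "Blinfun g x = g x" for x
    by (simp add: bounded_linear_Blinfun_apply)
  have "g (s *\<^sub>C x) = s *\<^sub>C g x" for s x
    by (rule inj) (use T in \<open>simp add: g bounded_operators_iff\<close>)
  then have "Blinfun g \<in> bounded_operators"
    by (simp add: bounded_operators_iff G)
  moreover have "g (T x) = x" for x
    by (rule inj) (simp add: g)
  then have "T o\<^sub>L Blinfun g = id_blinfun" "Blinfun g o\<^sub>L T = id_blinfun"
    by (simp_all add: blinfun_eqI G g)
  ultimately show ?thesis
    by (auto simp: invertible_op_def)
qed

text \<open>The proof rests on \<open>\<parallel>(\<parallel>T\<parallel>\<^sup>2 - T\<^sup>2) x\<parallel>\<^sup>2 \<le> \<parallel>T\<parallel>\<^sup>2 (\<parallel>T\<parallel>\<^sup>2 \<parallel>x\<parallel>\<^sup>2 - \<parallel>T x\<parallel>\<^sup>2)\<close>, whose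
  right-hand side is small when \<open>x\<close> nearly attains the norm.\<close>

lemma norm_square_diff_not_invertible:
  fixes T :: "'h::chilbert_space operator"
  assumes T: "self_adjoint T" and nz: "T \<noteq> 0"
  shows "\<not> invertible_op ((norm T)\<^sup>2 *\<^sub>R id_blinfun - (T o\<^sub>L T))"
proof
  define M where "M = norm T"
  have M: "M > 0" using nz by (simp add: M_def)
  define S where "S = M\<^sup>2 *\<^sub>R id_blinfun - (T o\<^sub>L T)"
  assume "invertible_op ((norm T)\<^sup>2 *\<^sub>R id_blinfun - (T o\<^sub>L T))"
  then obtain B where "B o\<^sub>L S = id_blinfun"
    by (auto simp: invertible_op_def S_def M_def)
  then have B: "B (S x) = x" for x
    by (metis blinfun_apply_blinfun_compose blinfun_apply_id_blinfun id_apply)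
  \<comment> \<open>A left inverse \<open>B\<close> of \<open>S\<close> turns the estimate for S x
    into ||x||^2 \<le> K (M^2 ||x||^2 - ||T x||^2), which would push the norm of \<open>T\<close>
    strictly below M. The summand 1 keeps K positive even if B = 0.\<close>
  define K where "K = (norm B)\<^sup>2 * M\<^sup>2 + 1"
  have K: "K > 0" by (simp add: K_def add_nonneg_pos)
  have S: "(norm (S x))\<^sup>2 \<le> M\<^sup>2 * (M\<^sup>2 * (norm x)\<^sup>2 - (norm (T x))\<^sup>2)" for x
  proof -
    have "(norm (S x))\<^sup>2 = M^4 * (norm x)\<^sup>2 - 2 * M\<^sup>2 * inner (T (T x)) x + (norm (T (T x)))\<^sup>2"
      unfolding power2_norm_eq_inner S_def
      by (simp add: blinfun.diff_left blinfun.scaleR_left inner_diff_left inner_diff_right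
          inner_commute power4_eq_xxxx power2_eq_square algebra_simps)
    moreover have "inner (T (T x)) x = (norm (T x))\<^sup>2"
      by (simp add: self_adjointD[OF T, of "T x"] power2_norm_eq_inner)
    moreover have "(norm (T (T x)))\<^sup>2 \<le> M\<^sup>2 * (norm (T x))\<^sup>2"
      using norm_blinfun[of T "T x"] unfolding M_def
      by (metis norm_ge_zero power_mono power_mult_distrib)
    ultimately show ?thesis
      by (simp add: algebra_simps power4_eq_xxxx power2_eq_square)
  qed
  \<comment> \<open>The maximum with 0 guards the root: M^2 - 1/K may be negative.\<close>
  define c where "c = sqrt (max 0 (M\<^sup>2 - 1 / K))"
  have "norm (T x) \<le> c * norm x" for x
  proof -
    have "norm x \<le> norm B * norm (S x)"
      using norm_blinfun[of B "S x"] by (simp add: B)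
    then have "(norm x)\<^sup>2 \<le> (norm B)\<^sup>2 * (norm (S x))\<^sup>2"
      by (metis norm_ge_zero power_mono power_mult_distrib)
    also have "\<dots> \<le> (norm B)\<^sup>2 * (M\<^sup>2 * (M\<^sup>2 * (norm x)\<^sup>2 - (norm (T x))\<^sup>2))"
      using S by (intro mult_left_mono) auto
    also have "\<dots> \<le> K * (M\<^sup>2 * (norm x)\<^sup>2 - (norm (T x))\<^sup>2)"
    proof -
      have "norm (T x) \<le> M * norm x"
        unfolding M_def by (rule norm_blinfun)
      then have "(norm (T x))\<^sup>2 \<le> M\<^sup>2 * (norm x)\<^sup>2"
        by (metis norm_ge_zero power_mono power_mult_distrib)
      then show ?thesis
        unfolding K_def by (simp add: algebra_simps)
    qed
    finally have "(norm (T x))\<^sup>2 \<le> (M\<^sup>2 - 1 / K) * (norm x)\<^sup>2"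
      using K by (simp add: field_simps)
    also have "\<dots> \<le> max 0 (M\<^sup>2 - 1 / K) * (norm x)\<^sup>2"
      by (intro mult_right_mono) auto
    also have "\<dots> = (c * norm x)\<^sup>2"
      by (simp add: c_def power_mult_distrib)
    finally show ?thesis
      by (rule power2_le_imp_le) (simp add: c_def)
  qed
  then have "M \<le> c"
    unfolding M_def by (intro norm_blinfun_bound) (auto simp: c_def)
  moreover have "c < M"
    unfolding c_def using M K by (intro real_less_lsqrt) auto
  ultimately show False by simp
qed

section \<open>Polynomials of a self-adjoint operator\<close>

lemma blinfun_compose_assoc: "(A o\<^sub>L B) o\<^sub>L C = A o\<^sub>L (B o\<^sub>L C)"
  by (rule blinfun_eqI) simp

lemma blinfun_compose_id [simp]: "A o\<^sub>L id_blinfun = A" "id_blinfun o\<^sub>L A = A"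
  by (auto intro: blinfun_eqI)

lemmas blinfun_compose_simps = bounded_bilinear.add_left[OF bounded_bilinear_blinfun_compose]
  bounded_bilinear.add_right[OF bounded_bilinear_blinfun_compose]
  bounded_bilinear.diff_left[OF bounded_bilinear_blinfun_compose]
  bounded_bilinear.diff_right[OF bounded_bilinear_blinfun_compose]
  bounded_bilinear.scaleR_left[OF bounded_bilinear_blinfun_compose]
  bounded_bilinear.scaleR_right[OF bounded_bilinear_blinfun_compose]

lemma poly_op_sum:
  assumes "degree p \<le> n"
  shows "poly_op p A = (\<Sum>i\<le>n. coeff p i *\<^sub>R (((o\<^sub>L) A ^^ i) id_blinfun))"
  unfolding poly_op_def
  by (rule sum.mono_neutral_left) (use assms in \<open>auto simp: coeff_eq_0\<close>)

lemma poly_op_0 [simp]: "poly_op 0 A = 0"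
  by (simp add: poly_op_def)

lemma poly_op_pCons [simp]: "poly_op (pCons c p) A = c *\<^sub>R id_blinfun + (A o\<^sub>L poly_op p A)"
  by (simp add: poly_op_sum[OF degree_pCons_le] sum.atMost_Suc_shift blinfun_compose_simps
      bounded_bilinear.sum_right[OF bounded_bilinear_blinfun_compose] poly_op_def del: sum.atMost_Suc)

lemma poly_op_add: "poly_op (p + q) A = poly_op p A + poly_op q A"
proof -
  define n where "n = max (degree p) (degree q)"
  have "degree (p + q) \<le> n" "degree p \<le> n" "degree q \<le> n"
    by (auto simp: n_def degree_add_le_max)
  then show ?thesis
    by (simp add: poly_op_sum scaleR_add_left sum.distrib)
qed

lemma poly_op_smult: "poly_op (smult c p) A = c *\<^sub>R poly_op p A"
  by (induction p) (simp_all add: blinfun_compose_simps scaleR_add_right)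

lemma poly_op_diff: "poly_op (p - q) A = poly_op p A - poly_op q A"
proof -
  have "p - q = p + smult (-1) q" by simp
  then show ?thesis by (simp only: poly_op_add poly_op_smult) simp
qed

lemma poly_op_mult: "poly_op (p * q) A = poly_op p A o\<^sub>L poly_op q A"
  by (induction p)
     (simp_all add: poly_op_add poly_op_smult blinfun_compose_simps blinfun_compose_assoc)

lemma poly_op_commute: "poly_op p A o\<^sub>L poly_op q A = poly_op q A o\<^sub>L poly_op p A"
  by (metis mult.commute poly_op_mult)

lemma self_adjoint_poly_op:
  assumes A: "self_adjoint A"
  shows "self_adjoint (poly_op p A)"
proof (induction p)
  case 0
  show ?case using self_adjoint_scaleR[OF self_adjoint_id, of 0] by simp
next
  case (pCons c p)
  have "self_adjoint (A o\<^sub>L poly_op p A)"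
    using A pCons poly_op_commute[of "[:0, 1:]" A p] by (intro self_adjoint_compose) simp_all
  then show ?case
    by (simp add: self_adjoint_add self_adjoint_scaleR self_adjoint_id)
qed

definition real_spectrum :: "'h::chilbert_space operator \<Rightarrow> real set" where
  "real_spectrum A = {t. complex_of_real t \<in> spectrum A}"

lemma real_spectrum_iff: "t \<in> real_spectrum A \<longleftrightarrow> \<not> invertible_op (A - t *\<^sub>R id_blinfun)"
  by (simp add: real_spectrum_def spectrum_def scalar_of_real)

lemma poly_map_poly_of_real:
  "poly (map_poly complex_of_real p) (of_real x) = of_real (poly p x)"
  by (induction p) (simp_all add: map_poly_pCons)

lemma map_poly_of_real_add:
  "map_poly complex_of_real (p + q) = map_poly complex_of_real p + map_poly complex_of_real q"
  by (rule poly_eqI) (simp add: coeff_map_poly)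

lemma poly_map_poly_of_real_mult:
  "poly (map_poly complex_of_real (p * q)) z
    = poly (map_poly complex_of_real p) z * poly (map_poly complex_of_real q) z"
  by (induction p) (simp_all add: map_poly_of_real_add map_poly_smult map_poly_pCons algebra_simps)

text \<open>The divisor is (X - z)(X - cnj z). Its remainder in \<open>p\<close> is a real
  polynomial u + v X vanishing at z; as z is not real, v = 0 and then u = 0.\<close>

lemma quadratic_dvd_of_complex_root:
  assumes root: "poly (map_poly complex_of_real p) z = 0" and im: "Im z \<noteq> 0"
  shows "[:(cmod z)\<^sup>2, - 2 * Re z, 1:] dvd p"
proof -
  define D where "D = [:(cmod z)\<^sup>2, - 2 * Re z, 1:]"
  have D: "poly (map_poly complex_of_real D) z = 0"
    using cmod_power2[of z]
    by (simp add: D_def map_poly_pCons complex_eq_iff power2_eq_square algebra_simps)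
  define r where "r = p mod D"
  have "degree r < 2"
    using degree_mod_less[of D p] by (auto simp: r_def D_def)
  then have "r = [:coeff r 0, coeff r 1:]"
    by (intro poly_eqI) (auto simp: coeff_pCons coeff_eq_0 split: nat.split)
  then obtain u v where r: "r = [:u, v:]" by blast
  have "poly (map_poly complex_of_real (D * (p div D) + r)) z = 0"
    using root by (simp add: r_def)
  then have "poly (map_poly complex_of_real r) z = 0"
    by (simp add: map_poly_of_real_add poly_map_poly_of_real_mult D)
  then have "u = 0 \<and> v = 0"
    using im by (auto simp: r map_poly_pCons complex_eq_iff)
  then show ?thesis
    using r r_def by (simp add: D_def mod_eq_0_iff_dvd)
qed

text \<open>One half of spectral mapping, by splitting off real factors of \<open>p\<close>. A real
  root lies outside the spectrum, so its linear factor is invertible by definition; a conjugate pair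
  of non-real roots gives a quadratic factor that is coercive whatever the spectrum is.\<close>

lemma poly_op_invertible:
  fixes A :: "'h::chilbert_space operator"
  assumes A: "self_adjoint A" and "p \<noteq> 0"
    and "\<And>t. t \<in> real_spectrum A \<Longrightarrow> poly p t \<noteq> 0"
  shows "invertible_op (poly_op p A)"
  using assms(2,3)
proof (induction "degree p" arbitrary: p rule: less_induct)
  case (less p)
  have quotient: "invertible_op (poly_op p A)"
    if p: "p = D * q" and "degree D > 0" and D: "invertible_op (poly_op D A)" for D q
  proof -
    have "D \<noteq> 0" "q \<noteq> 0" using less.prems(1) p by auto
    then have "degree q < degree p" using \<open>degree D > 0\<close> by (simp add: p degree_mult_eq)
    then have "invertible_op (poly_op q A)"
      using less.prems by (intro less.hyps) (auto simp: p)
    then show ?thesis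
      unfolding p poly_op_mult using D by (rule invertible_op_compose[rotated])
  qed
  show ?case
  proof (cases "degree p = 0")
    case True
    then obtain c where c: "p = [:c:]" "c \<noteq> 0"
      using less.prems(1) by (metis degree_eq_zeroE pCons_0_0)
    then show ?thesis
      unfolding invertible_op_def
      by (intro bexI[of _ "(1 / c) *\<^sub>R id_blinfun"])
         (auto simp: blinfun_compose_simps bounded_operators_scaleR bounded_operators_id)
  next
    case False
    then have "\<not> constant (poly (map_poly complex_of_real p))"
      by (simp add: constant_degree degree_map_poly)
    then obtain z where z: "poly (map_poly complex_of_real p) z = 0"
      using fundamental_theorem_of_algebra by blast
    show ?thesis
    proof (cases "Im z = 0")
      case True
      then have "z = of_real (Re z)" by (simp add: complex_eq_iff)
      then have "complex_of_real (poly p (Re z)) = 0"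
        using z by (metis poly_map_poly_of_real)
      then have root: "poly p (Re z) = 0" by simp
      then obtain q where "p = [:- Re z, 1:] * q"
        by (auto simp: poly_eq_0_iff_dvd elim: dvdE)
      moreover have "invertible_op (A - Re z *\<^sub>R id_blinfun)"
        using less.prems(2) root real_spectrum_iff by blast
      ultimately show ?thesis
        by (intro quotient[of "[:- Re z, 1:]" q]) auto
    next
      case False
      define D where "D = [:(cmod z)\<^sup>2, - 2 * Re z, 1:]"
      obtain q where "p = D * q"
        using quadratic_dvd_of_complex_root[OF z False] by (auto simp: D_def elim: dvdE)
      moreover have "invertible_op (poly_op D A)"
      proof (rule coercive_invertible)
        show "poly_op D A \<in> bounded_operators"
          using self_adjoint_poly_op[OF A] self_adjoint_bounded by blast
        show "(Im z)\<^sup>2 > 0" using False by simp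
        fix x
        \<comment> \<open>Completing the square: D(A) = (A - Re z)^2 + (Im z)^2.\<close>
        define y where "y = A x - Re z *\<^sub>R x"
        have "inner (poly_op D A x) x
            = (cmod z)\<^sup>2 * inner x x - 2 * Re z * inner (A x) x + inner (A (A x)) x"
          by (simp add: D_def blinfun.bilinear_simps inner_add_left inner_diff_left)
        also have "\<dots> = (Im z)\<^sup>2 * inner x x + inner y y"
          unfolding self_adjointD[OF A, of "A x"] cmod_power2
          by (simp add: y_def inner_diff_left inner_diff_right inner_commute power2_eq_square
              algebra_simps)
        finally show "inner (poly_op D A x) x \<ge> (Im z)\<^sup>2 * (norm x)\<^sup>2"
          by (simp add: power2_norm_eq_inner)
      qed
      ultimately show ?thesis
        by (intro quotient[of D q]) (auto simp: D_def)
    qed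
  qed
qed

text \<open>If M = ||p(A)|| exceeded e, then M^2 - p^2 would be positive on the spectrum, making M^2
  - p(A)^2 invertible; but that operator never is.\<close>

lemma norm_poly_op_le:
  fixes A :: "'h::chilbert_space operator"
  assumes A: "self_adjoint A" and e: "e \<ge> 0"
    and le: "\<And>t. t \<in> real_spectrum A \<Longrightarrow> \<bar>poly p t\<bar> \<le> e"
  shows "norm (poly_op p A) \<le> e"
proof (rule ccontr)
  assume contr: "\<not> norm (poly_op p A) \<le> e"
  define M where "M = norm (poly_op p A)"
  define S where "S = [:M\<^sup>2:] - p * p"
  have S_op: "poly_op S A = M\<^sup>2 *\<^sub>R id_blinfun - (poly_op p A o\<^sub>L poly_op p A)"
    by (simp add: S_def poly_op_diff poly_op_mult)
  have "poly_op p A \<noteq> 0" using contr e by auto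
  then have not_inv: "\<not> invertible_op (poly_op S A)"
    unfolding S_op M_def
    by (rule norm_square_diff_not_invertible[OF self_adjoint_poly_op[OF A]])
  have S_pos: "poly S t > 0" if "t \<in> real_spectrum A" for t
  proof -
    have "\<bar>poly p t\<bar> < \<bar>M\<bar>" using le[OF that] contr e by (simp add: M_def)
    then have "(poly p t)\<^sup>2 < M\<^sup>2" by (metis power2_abs power_strict_mono abs_ge_zero zero_less_numeral)
    then show ?thesis by (simp add: S_def power2_eq_square)
  qed
  show False
  proof (cases "S = 0")
    case False
    then show False
      using poly_op_invertible[OF A False] S_pos not_inv by fastforce
  next
    case True
    \<comment> \<open>The degenerate case M^2 = p^2, where the invertibility lemma does not apply.
      Positivity of \<open>S\<close> on the spectrum then leaves no spectrum at all. For A = 0 this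
      makes the whole space trivial, contradicting p(A) \<noteq> 0; for A \<noteq> 0 it would make
      ||A||^2 - A^2 invertible.\<close>
    then have empty: "t \<notin> real_spectrum A" for t
      using S_pos[of t] by auto
    show False
    proof (cases "A = 0")
      case True
      then have "invertible_op (0 :: 'h operator)"
        using empty[of 0] by (simp add: real_spectrum_iff)
      then have "id_blinfun = (0 :: 'h operator)"
        by (auto simp: invertible_op_def)
      then have "poly_op p A = 0"
        by (metis blinfun_compose_id(1) blinfun_compose_zero(2))
      with \<open>poly_op p A \<noteq> 0\<close> show False by simp
    next
      case False
      have "invertible_op (poly_op [:(norm A)\<^sup>2, 0, -1:] A)"
        using empty by (intro poly_op_invertible[OF A]) auto
      then show False
        using norm_square_diff_not_invertible[OF A False]
        by (simp add: bounded_bilinear.minus_right[OF bounded_bilinear_blinfun_compose])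
    qed
  qed
qed

section \<open>Continuous functional calculus\<close>

lemma uniform_polynomial_approximation:
  fixes f :: "real \<Rightarrow> real"
  assumes "compact K" "continuous_on K f"
  shows "\<exists>p. uniform_limit K (\<lambda>n t. poly (p n) t) f sequentially"
proof -
  have "\<exists>p. \<forall>t\<in>K. \<bar>f t - poly p t\<bar> < inverse (real (Suc n))" for n
  proof -
    obtain g where g: "real_polynomial_function g" "\<And>x. x \<in> K \<Longrightarrow> \<bar>f x - g x\<bar> < inverse (real (Suc n))"
      using Stone_Weierstrass_real_polynomial_function[OF assms, of "inverse (real (Suc n))"] by auto
    obtain a m where "g = (\<lambda>x. \<Sum>i\<le>(m::nat). a i * x ^ i)"
      using g(1) real_polynomial_function_iff_sum by auto
    then have "g x = poly (\<Sum>i\<le>m. monom (a i) i) x" for x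
      by (simp add: poly_sum poly_monom)
    with g(2) show ?thesis by auto
  qed
  then obtain p where p: "\<And>n t. t \<in> K \<Longrightarrow> \<bar>f t - poly (p n) t\<bar> < inverse (real (Suc n))"
    by metis
  have "uniform_limit K (\<lambda>n t. poly (p n) t) f sequentially"
  proof (rule uniform_limitI)
    fix e :: real assume "e > 0"
    then have "\<forall>\<^sub>F n in sequentially. inverse (real (Suc n)) < e"
      by (rule order_tendstoD(2)[OF LIMSEQ_inverse_real_of_nat])
    then show "\<forall>\<^sub>F n in sequentially. \<forall>t\<in>K. dist (poly (p n) t) (f t) < e"
      by eventually_elim (metis abs_minus_commute dist_real_def order.strict_trans p)
  qed
  then show ?thesis by (rule exI[of _ p])
qed

text \<open>Needs neither continuity nor self-adjointness: the description defining
  \<open>cfc\<close> sees a function only through its values on the spectrum. Identities valid just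
  on [a,b], such as sqrt(f) sqrt(f) = f, enter the calculus this way.\<close>

lemma cfc_cong: "(\<And>t. t \<in> real_spectrum A \<Longrightarrow> f t = g t) \<Longrightarrow> cfc f A = cfc g A"
  unfolding cfc_def real_spectrum_def[symmetric]
  by (intro arg_cong[where f = The] ext all_cong1 imp_cong[OF _ refl] uniform_limit_cong') auto

text \<open>Continuity is asked on a compact set \<open>K\<close> containing the spectrum, not on
  the spectrum itself, so that \<open>A\<close> and \<open>\<Phi> A\<close> can share the interval
  [a,b] and f(A) can be treated over the image of \<open>K\<close>.\<close>

locale self_adjoint_operator =
  fixes A :: "'h::chilbert_space operator" and K :: "real set"
  assumes self_adjoint: "self_adjoint A"
    and compact: "compact K"
    and real_spectrum_subset: "real_spectrum A \<subseteq> K"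
begin

lemma poly_op_diff_le:
  assumes "e \<ge> 0" "\<forall>t\<in>real_spectrum A. dist (poly p t) (f t) < e / 2"
    and "\<forall>t\<in>real_spectrum A. dist (poly q t) (f t) < e / 2"
  shows "norm (poly_op p A - poly_op q A) \<le> e"
proof -
  have "\<bar>poly (p - q) t\<bar> \<le> e" if "t \<in> real_spectrum A" for t
    using bspec[OF assms(2) that] bspec[OF assms(3) that]
    unfolding dist_real_def poly_diff by linarith
  then show ?thesis
    unfolding poly_op_diff[symmetric] by (intro norm_poly_op_le self_adjoint assms(1))
qed

text \<open>Shows that the description in \<open>cfc\<close> is well defined. The norm bound makes
  p_n(A) Cauchy for one Weierstrass sequence p_n and gives every other admissible sequence the same
  limit; the existence of p_n makes that limit unique.\<close>

lemma cfc_LIMSEQ: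
  assumes f: "continuous_on K f"
    and q: "uniform_limit (real_spectrum A) (\<lambda>n t. poly (q n) t) f sequentially"
  shows "(\<lambda>n. poly_op (q n) A) \<longlonglongrightarrow> cfc f A"
proof -
  obtain p where "uniform_limit K (\<lambda>n t. poly (p n) t) f sequentially"
    using uniform_polynomial_approximation[OF compact f] by blast
  then have p: "uniform_limit (real_spectrum A) (\<lambda>n t. poly (p n) t) f sequentially"
    using real_spectrum_subset by (rule uniform_limit_on_subset)
  have "Cauchy (\<lambda>n. poly_op (p n) A)"
  proof (rule CauchyI)
    fix e :: real assume e: "e > 0"
    then obtain N where N: "\<And>n. n \<ge> N \<Longrightarrow> \<forall>t\<in>real_spectrum A. dist (poly (p n) t) (f t) < e / 2 / 2"
      using uniform_limitD[OF p, of "e / 2 / 2"] by (auto simp: eventually_sequentially)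
    have "norm (poly_op (p m) A - poly_op (p n) A) < e" if "m \<ge> N" "n \<ge> N" for m n
      using poly_op_diff_le[OF _ N[OF that(1)] N[OF that(2)]] e by simp
    then show "\<exists>N. \<forall>m\<ge>N. \<forall>n\<ge>N. norm (poly_op (p m) A - poly_op (p n) A) < e"
      by blast
  qed
  then obtain T where T: "(\<lambda>n. poly_op (p n) A) \<longlonglongrightarrow> T"
    using Cauchy_convergent convergentD by blast
  have lim: "(\<lambda>n. poly_op (r n) A) \<longlonglongrightarrow> T"
    if r: "uniform_limit (real_spectrum A) (\<lambda>n t. poly (r n) t) f sequentially" for r
  proof -
    have "(\<lambda>n. poly_op (r n) A - poly_op (p n) A) \<longlonglongrightarrow> 0"
    proof (rule tendstoI)
      fix e :: real assume e: "e > 0"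
      then have "e / 2 / 2 > 0" by simp
      from uniform_limitD[OF p this] uniform_limitD[OF r this]
      show "\<forall>\<^sub>F n in sequentially. dist (poly_op (r n) A - poly_op (p n) A) 0 < e"
      proof eventually_elim
        case (elim n)
        then have "norm (poly_op (r n) A - poly_op (p n) A) \<le> e / 2"
          using e by (intro poly_op_diff_le) auto
        with e show ?case by simp
      qed
    qed
    from tendsto_add[OF this T] show ?thesis by simp
  qed
  have "cfc f A = T"
    unfolding cfc_def real_spectrum_def[symmetric]
    by (rule the_equality) (use lim p LIMSEQ_unique in blast)+
  then show ?thesis
    using lim[OF q] by simp
qed

lemma cfc_approximation:
  assumes "continuous_on K f"
  obtains p where "uniform_limit K (\<lambda>n t. poly (p n) t) f sequentially"
    and "(\<lambda>n. poly_op (p n) A) \<longlonglongrightarrow> cfc f A"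
  using uniform_polynomial_approximation[OF compact assms] cfc_LIMSEQ[OF assms]
    uniform_limit_on_subset[OF _ real_spectrum_subset] by blast

lemma cfc_poly: "cfc (poly p) A = poly_op p A"
proof -
  have "(\<lambda>n. poly_op p A) \<longlonglongrightarrow> cfc (poly p) A"
    by (rule cfc_LIMSEQ) (auto intro: continuous_intros uniform_limitI)
  then show ?thesis
    using LIMSEQ_unique tendsto_const by blast
qed

lemma cfc_const: "cfc (\<lambda>t. c) A = c *\<^sub>R id_blinfun"
  using cfc_poly[of "[:c:]"] cfc_cong[of A "poly [:c:]" "\<lambda>t. c"] by simp

lemma cfc_id: "cfc (\<lambda>t. t) A = A"
  using cfc_poly[of "[:0, 1:]"] cfc_cong[of A "poly [:0, 1:]" "\<lambda>t. t"] by simp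

lemma cfc_add:
  assumes f: "continuous_on K f" and g: "continuous_on K g"
  shows "cfc (\<lambda>t. f t + g t) A = cfc f A + cfc g A"
proof -
  obtain p where p: "uniform_limit K (\<lambda>n t. poly (p n) t) f sequentially"
      "(\<lambda>n. poly_op (p n) A) \<longlonglongrightarrow> cfc f A"
    using cfc_approximation[OF f] .
  obtain q where q: "uniform_limit K (\<lambda>n t. poly (q n) t) g sequentially"
      "(\<lambda>n. poly_op (q n) A) \<longlonglongrightarrow> cfc g A"
    using cfc_approximation[OF g] .
  have "uniform_limit K (\<lambda>n t. poly (p n + q n) t) (\<lambda>t. f t + g t) sequentially"
    using uniform_limit_add[OF p(1) q(1)] by simp
  then have "(\<lambda>n. poly_op (p n + q n) A) \<longlonglongrightarrow> cfc (\<lambda>t. f t + g t) A"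
    by (intro cfc_LIMSEQ continuous_intros f g uniform_limit_on_subset[OF _ real_spectrum_subset])
  moreover have "(\<lambda>n. poly_op (p n + q n) A) \<longlonglongrightarrow> cfc f A + cfc g A"
    unfolding poly_op_add by (intro tendsto_add p q)
  ultimately show ?thesis
    using LIMSEQ_unique by blast
qed

lemma cfc_mult:
  assumes f: "continuous_on K f" and g: "continuous_on K g"
  shows "cfc (\<lambda>t. f t * g t) A = cfc f A o\<^sub>L cfc g A"
proof -
  obtain p where p: "uniform_limit K (\<lambda>n t. poly (p n) t) f sequentially"
      "(\<lambda>n. poly_op (p n) A) \<longlonglongrightarrow> cfc f A"
    using cfc_approximation[OF f] .
  obtain q where q: "uniform_limit K (\<lambda>n t. poly (q n) t) g sequentially"
      "(\<lambda>n. poly_op (q n) A) \<longlonglongrightarrow> cfc g A"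
    using cfc_approximation[OF g] .
  have "bounded (f ` K)" "bounded (g ` K)"
    using compact f g by (auto intro: compact_imp_bounded compact_continuous_image)
  then have "uniform_limit K (\<lambda>n t. poly (p n * q n) t) (\<lambda>t. f t * g t) sequentially"
    using uniform_lim_mult[OF p(1) q(1)] by simp
  then have "(\<lambda>n. poly_op (p n * q n) A) \<longlonglongrightarrow> cfc (\<lambda>t. f t * g t) A"
    by (intro cfc_LIMSEQ continuous_intros f g uniform_limit_on_subset[OF _ real_spectrum_subset])
  moreover have "(\<lambda>n. poly_op (p n * q n) A) \<longlonglongrightarrow> (cfc f A o\<^sub>L cfc g A)"
    unfolding poly_op_mult
    by (intro bounded_bilinear.tendsto[OF bounded_bilinear_blinfun_compose] p q)
  ultimately show ?thesis
    using LIMSEQ_unique by blast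
qed

lemma cfc_scaleR: "continuous_on K f \<Longrightarrow> cfc (\<lambda>t. c * f t) A = c *\<^sub>R cfc f A"
  using cfc_mult[of "\<lambda>t. c" f] by (simp add: cfc_const blinfun_compose_simps continuous_intros)

lemma cfc_diff:
  assumes f: "continuous_on K f" and g: "continuous_on K g"
  shows "cfc (\<lambda>t. f t - g t) A = cfc f A - cfc g A"
proof -
  have "cfc (\<lambda>t. f t + (- 1) * g t) A = cfc f A + (- 1) *\<^sub>R cfc g A"
    by (subst cfc_add, intro f, intro continuous_intros g, subst cfc_scaleR, intro g, rule refl)
  then show ?thesis by simp
qed

lemma cfc_sum:
  assumes "finite I" "\<And>i. i \<in> I \<Longrightarrow> continuous_on K (f i)"
  shows "cfc (\<lambda>t. \<Sum>i\<in>I. f i t) A = (\<Sum>i\<in>I. cfc (f i) A)"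
  using assms
proof (induction I rule: finite_induct)
  case empty
  show ?case using cfc_const[of 0] by simp
next
  case (insert i I)
  then have "cfc (\<lambda>t. f i t + (\<Sum>i\<in>I. f i t)) A = cfc (f i) A + (\<Sum>i\<in>I. cfc (f i) A)"
    by (subst cfc_add) (auto intro: continuous_on_sum)
  with insert show ?case by simp
qed

lemma self_adjoint_cfc: "continuous_on K f \<Longrightarrow> self_adjoint (cfc f A)"
  by (metis cfc_approximation self_adjoint_LIMSEQ self_adjoint_poly_op[OF self_adjoint])

lemma cfc_in_closed:
  assumes "continuous_on K f" "closed S" "\<And>p. poly_op p A \<in> S"
  shows "cfc f A \<in> S"
  by (metis assms cfc_approximation closed_sequentially)

text \<open>f(A) is the square of the self-adjoint operator sqrt(f)(A). The total function
  \<open>sqrt\<close> is continuous everywhere, so the sign of f matters only for the identity on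
  the spectrum.\<close>

lemma positive_op_cfc:
  assumes f: "continuous_on K f" and nonneg: "\<And>t. t \<in> K \<Longrightarrow> f t \<ge> 0"
  shows "positive_op (cfc f A)"
proof -
  have root: "continuous_on K (\<lambda>t. sqrt (f t))"
    by (intro continuous_intros f)
  have "cfc f A = cfc (\<lambda>t. sqrt (f t) * sqrt (f t)) A"
    using real_spectrum_subset nonneg by (intro cfc_cong) (simp add: subset_iff)
  then show ?thesis
    unfolding cfc_mult[OF root root] by (simp only: positive_op_square self_adjoint_cfc[OF root])
qed

lemma norm_cfc_le:
  assumes f: "continuous_on K f" and e: "e \<ge> 0" and le: "\<And>t. t \<in> K \<Longrightarrow> \<bar>f t\<bar> \<le> e"
  shows "norm (cfc f A) \<le> e"
proof (rule field_le_epsilon)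
  fix d :: real assume d: "d > 0"
  obtain p where p: "uniform_limit K (\<lambda>n t. poly (p n) t) f sequentially"
      "(\<lambda>n. poly_op (p n) A) \<longlonglongrightarrow> cfc f A"
    using cfc_approximation[OF f] .
  have "\<forall>\<^sub>F n in sequentially. norm (poly_op (p n) A) \<le> e + d"
    using uniform_limitD[OF p(1) d]
  proof eventually_elim
    case (elim n)
    have "\<bar>poly (p n) t\<bar> \<le> e + d" if "t \<in> real_spectrum A" for t
      using elim le[of t] that real_spectrum_subset by (fastforce simp: dist_real_def)
    then show ?case
      using e d by (intro norm_poly_op_le[OF self_adjoint]) auto
  qed
  with tendsto_norm[OF p(2)] show "norm (cfc f A) \<le> e + d"
    by (intro tendsto_upperbound) auto
qed

text \<open>For s outside the image, 1/(f - s) is continuous on \<open>K\<close>, and its value at A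
  inverts f(A) - s.\<close>

lemma real_spectrum_cfc:
  assumes f: "continuous_on K f"
  shows "real_spectrum (cfc f A) \<subseteq> f ` K"
proof
  fix s assume s: "s \<in> real_spectrum (cfc f A)"
  show "s \<in> f ` K"
  proof (rule ccontr)
    assume "s \<notin> f ` K"
    then have nz: "f t - s \<noteq> 0" if "t \<in> K" for t using that by auto
    have cont: "continuous_on K (\<lambda>t. f t - s)" "continuous_on K (\<lambda>t. 1 / (f t - s))"
      using nz by (auto intro!: continuous_intros f)
    have "cfc (\<lambda>t. (f t - s) * (1 / (f t - s))) A = cfc (\<lambda>t. 1) A"
         "cfc (\<lambda>t. (1 / (f t - s)) * (f t - s)) A = cfc (\<lambda>t. 1) A"
      using nz real_spectrum_subset by (auto intro!: cfc_cong)
    then have "cfc (\<lambda>t. f t - s) A o\<^sub>L cfc (\<lambda>t. 1 / (f t - s)) A = id_blinfun"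
        "cfc (\<lambda>t. 1 / (f t - s)) A o\<^sub>L cfc (\<lambda>t. f t - s) A = id_blinfun"
      by (simp_all only: cfc_mult cont cfc_const scaleR_one)
    moreover have "cfc (\<lambda>t. 1 / (f t - s)) A \<in> bounded_operators"
      by (intro self_adjoint_bounded self_adjoint_cfc cont)
    ultimately have "invertible_op (cfc (\<lambda>t. f t - s) A)"
      unfolding invertible_op_def by blast
    then show False
      using s by (simp add: real_spectrum_iff cfc_diff f continuous_intros cfc_const)
  qed
qed

lemma self_adjoint_operator_cfc:
  "continuous_on K f \<Longrightarrow> self_adjoint_operator (cfc f A) (f ` K)"
  by (intro self_adjoint_operator.intro self_adjoint_cfc real_spectrum_cfc
      compact_continuous_image compact)

text \<open>For polynomial g this is Horner induction. In general p_n(f(A)) has two limits: g(f(A))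
  by the calculus of f(A), and (g o f)(A) because p_n o f - g o f is uniformly small on
  \<open>K\<close>.\<close>

lemma cfc_compose:
  assumes f: "continuous_on K f" and g: "continuous_on (f ` K) g"
  shows "cfc g (cfc f A) = cfc (\<lambda>t. g (f t)) A"
proof -
  interpret B: self_adjoint_operator "cfc f A" "f ` K"
    by (rule self_adjoint_operator_cfc[OF f])
  have gf: "continuous_on K (\<lambda>t. g (f t))"
    by (rule continuous_on_compose2[OF g f]) simp
  obtain p where p: "uniform_limit (f ` K) (\<lambda>n t. poly (p n) t) g sequentially"
      "(\<lambda>n. poly_op (p n) (cfc f A)) \<longlonglongrightarrow> cfc g (cfc f A)"
    using B.cfc_approximation[OF g] .
  have cont: "continuous_on K (\<lambda>t. poly q (f t))" for q
    by (intro continuous_intros f)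
  have poly: "poly_op q (cfc f A) = cfc (\<lambda>t. poly q (f t)) A" for q
  proof (induction q)
    case 0
    show ?case using cfc_const[of 0] by simp
  next
    case (pCons c q)
    then show ?case
      by (simp add: cfc_add cfc_mult cfc_const f cont continuous_intros)
  qed
  have "(\<lambda>n. poly_op (p n) (cfc f A)) \<longlonglongrightarrow> cfc (\<lambda>t. g (f t)) A"
  proof (rule tendstoI)
    fix e :: real assume e: "e > 0"
    then have "e / 2 > 0" by simp
    from uniform_limitD[OF p(1) this]
    show "\<forall>\<^sub>F n in sequentially. dist (poly_op (p n) (cfc f A)) (cfc (\<lambda>t. g (f t)) A) < e"
    proof eventually_elim
      case (elim n)
      have "norm (cfc (\<lambda>t. poly (p n) (f t) - g (f t)) A) \<le> e / 2"
        using elim e by (intro norm_cfc_le continuous_intros cont gf) (auto simp: dist_real_def less_imp_le)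
      then show ?case
        using e by (simp add: dist_norm poly cfc_diff cont gf)
    qed
  qed
  with p(2) show ?thesis
    using LIMSEQ_unique by blast
qed

end

section \<open>Affine minorants of convex functions\<close>

text \<open>Near y continuity suffices; at distance at least d the slope 2M/d lowers the cone by 2M,
  beyond the oscillation of g. At an endpoint |t - y| is affine on [a,b], so the cone is a line
  exactly where a supporting line may be missing.\<close>

lemma continuous_abs_minorant:
  fixes g :: "real \<Rightarrow> real"
  assumes g: "continuous_on {a..b} g" and y: "y \<in> {a..b}" and e: "e > 0"
  shows "\<exists>k. \<forall>t\<in>{a..b}. g y - e - k * \<bar>t - y\<bar> \<le> g t"
proof -
  obtain d where d: "d > 0" "\<And>t. t \<in> {a..b} \<Longrightarrow> dist t y < d \<Longrightarrow> dist (g t) (g y) < e"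
    using g y e unfolding continuous_on_iff by blast
  have "bounded (g ` {a..b})"
    by (intro compact_imp_bounded compact_continuous_image g) simp
  then obtain M where M: "\<And>t. t \<in> {a..b} \<Longrightarrow> \<bar>g t\<bar> \<le> M"
    unfolding bounded_iff by (auto simp del: atLeastAtMost_iff)
  have "M \<ge> 0" using M[OF y] by linarith
  have "g y - e - (2 * M / d) * \<bar>t - y\<bar> \<le> g t" if t: "t \<in> {a..b}" for t
  proof (cases "\<bar>t - y\<bar> < d")
    case True
    have "(2 * M / d) * \<bar>t - y\<bar> \<ge> 0" using d(1) \<open>M \<ge> 0\<close> by simp
    moreover have "\<bar>g t - g y\<bar> < e" using d(2)[OF t] True by (simp add: dist_real_def)
    ultimately show ?thesis by linarith
  next
    case False
    then have "(2 * M / d) * \<bar>t - y\<bar> \<ge> (2 * M / d) * d"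
      using d(1) \<open>M \<ge> 0\<close> by (intro mult_left_mono) auto
    then have "(2 * M / d) * \<bar>t - y\<bar> \<ge> 2 * M" using d(1) by simp
    moreover have "g y \<le> M" "- M \<le> g t" using M[OF t] M[OF y] by linarith+
    ultimately show ?thesis using e by linarith
  qed
  then show ?thesis by blast
qed

lemma convex_affine_minorant:
  fixes g :: "real \<Rightarrow> real"
  assumes g: "continuous_on {a..b} g" and convex: "convex_on {a..b} g"
    and y: "y \<in> {a..b}" and e: "e > 0"
  shows "\<exists>c d. (\<forall>t\<in>{a..b}. c * t + d \<le> g t) \<and> g y - e < c * y + d"
proof (cases "y \<in> {a<..<b}")
  case True
  then have "y \<in> interior {a..b}" by simp
  then obtain c where "\<And>t. t \<in> {a..b} \<Longrightarrow> g t \<ge> g y + c * (t - y)"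
    using convex_le_Inf_differential[OF convex] by blast
  then have "\<forall>t\<in>{a..b}. c * t + (g y - c * y) \<le> g t"
    by (simp add: algebra_simps)
  then show ?thesis
    using e by (intro exI[of _ c] exI[of _ "g y - c * y"]) auto
next
  case False
  \<comment> \<open>Half of e is spent on the cone, leaving the strict inequality at y.\<close>
  have "e / 2 > 0" using e by simp
  from continuous_abs_minorant[OF g y this]
  obtain k where k: "\<forall>t\<in>{a..b}. g y - e / 2 - k * \<bar>t - y\<bar> \<le> g t" by blast
  have "y = a \<or> y = b" using False y by auto
  then show ?thesis
  proof
    assume "y = a"
    then have "\<forall>t\<in>{a..b}. (- k) * t + (g y - e / 2 + k * y) \<le> g t"
      using k by (auto simp: algebra_simps)
    then show ?thesis
      using e by (intro exI[of _ "- k"] exI[of _ "g y - e / 2 + k * y"]) auto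
  next
    assume "y = b"
    then have "\<forall>t\<in>{a..b}. k * t + (g y - e / 2 - k * y) \<le> g t"
      using k by (auto simp: algebra_simps)
    then show ?thesis
      using e by (intro exI[of _ k] exI[of _ "g y - e / 2 - k * y"]) auto
  qed
qed

lemma convex_finite_affine_minorants:
  fixes g :: "real \<Rightarrow> real"
  assumes g: "continuous_on {a..b} g" and convex: "convex_on {a..b} g" and e: "e > 0"
  obtains I :: "(real \<times> real) set" where "finite I"
    and "\<And>c d t. (c, d) \<in> I \<Longrightarrow> t \<in> {a..b} \<Longrightarrow> c * t + d \<le> g t"
    and "\<And>t. t \<in> {a..b} \<Longrightarrow> \<exists>(c, d)\<in>I. g t - e < c * t + d"
proof -
  define C where "C = {(c, d). \<forall>t\<in>{a..b}. c * t + d \<le> g t}"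
  \<comment> \<open>The set where a minorant is within e of g is open only relative to [a,b]; open
    sets of the line inducing it are needed for the cover.\<close>
  have "\<exists>U. open U \<and> U \<inter> {a..b} = (\<lambda>t. c * t + d - g t) -` {- e<..} \<inter> {a..b}" for c d
    using g by (intro continuous_on_open_invariant[THEN iffD1, rule_format] continuous_intros) auto
  then obtain V where V: "\<And>c d. open (V c d)"
      "\<And>c d. V c d \<inter> {a..b} = (\<lambda>t. c * t + d - g t) -` {- e<..} \<inter> {a..b}"
    by metis
  define U where "U i = V (fst i) (snd i)" for i
  have cover: "{a..b} \<subseteq> \<Union> (U ` C)"
  proof
    fix y assume y: "y \<in> {a..b}"
    obtain c d where cd: "\<forall>t\<in>{a..b}. c * t + d \<le> g t" "g y - e < c * y + d"
      using convex_affine_minorant[OF g convex y e] by blast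
    then have "y \<in> U (c, d)" using V(2)[of c d] y by (auto simp: U_def)
    with cd(1) show "y \<in> \<Union> (U ` C)" by (auto simp: C_def)
  qed
  have U_open: "open (U i)" for i
    using V(1) by (simp add: U_def)
  obtain I where I: "I \<subseteq> C" "finite I" "{a..b} \<subseteq> \<Union> (U ` I)"
    using compactE_image[OF compact_Icc U_open cover] by blast
  show thesis
  proof
    show "finite I" by fact
    show "c * t + d \<le> g t" if "(c, d) \<in> I" "t \<in> {a..b}" for c d t
      using I(1) that by (auto simp: C_def)
    show "\<exists>(c, d)\<in>I. g t - e < c * t + d" if t: "t \<in> {a..b}" for t
    proof -
      obtain c d where "(c, d) \<in> I" "t \<in> U (c, d)" using I(3) t by auto
      then have "t \<in> V c d \<inter> {a..b}" using t by (simp add: U_def)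
      then have "g t - e < c * t + d" unfolding V(2) by simp
      with \<open>(c, d) \<in> I\<close> show ?thesis by auto
    qed
  qed
qed

section \<open>Von Neumann algebras and traces\<close>

text \<open>The strong operator topology is coarser than the norm topology. Hence the norm limits
  that define \<open>cfc\<close> stay in the algebra.\<close>

lemma closed_von_neumann_algebra:
  assumes "von_neumann_algebra R"
  shows "closed R"
proof -
  have "closedin euclidean {x \<in> topspace euclidean. x \<in> R}"
    using assms strong_operator_topology_weaker_than_euclidean
    by (intro closedin_continuous_map_preimage) (auto simp: von_neumann_algebra_def)
  then show ?thesis by simp
qed

locale tracial_von_neumann_algebra =
  fixes R :: "'h::chilbert_space operator set" and \<tau> :: "'h operator \<Rightarrow> complex"
  assumes algebra: "von_neumann_algebra R"
    and state: "state R \<tau>"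
    and tracial: "tracial R \<tau>"
begin

lemma id_in: "id_blinfun \<in> R"
  using algebra by (simp add: von_neumann_algebra_def)

lemma add_in: "X \<in> R \<Longrightarrow> Y \<in> R \<Longrightarrow> X + Y \<in> R"
  using algebra by (simp add: von_neumann_algebra_def)

lemma compose_in: "X \<in> R \<Longrightarrow> Y \<in> R \<Longrightarrow> (X o\<^sub>L Y) \<in> R"
  using algebra by (simp add: von_neumann_algebra_def)

lemma scaleR_in: "X \<in> R \<Longrightarrow> r *\<^sub>R X \<in> R"
  using algebra by (metis von_neumann_algebra_def scalar_of_real_compose)

lemma diff_in: "X \<in> R \<Longrightarrow> Y \<in> R \<Longrightarrow> X - Y \<in> R"
  using add_in[of X "(-1) *\<^sub>R Y"] scaleR_in[of Y "-1"] by simp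

lemma poly_op_in: "X \<in> R \<Longrightarrow> poly_op p X \<in> R"
  by (induction p) (use scaleR_in[of _ 0] in \<open>auto intro!: add_in compose_in scaleR_in id_in\<close>)

lemma cfc_in: "self_adjoint_operator X K \<Longrightarrow> continuous_on K f \<Longrightarrow> X \<in> R \<Longrightarrow> cfc f X \<in> R"
  by (intro self_adjoint_operator.cfc_in_closed closed_von_neumann_algebra algebra poly_op_in)

lemma trace_add: "X \<in> R \<Longrightarrow> Y \<in> R \<Longrightarrow> \<tau> (X + Y) = \<tau> X + \<tau> Y"
  using state by (simp add: state_def linear_on_algebra_def)

lemma trace_scaleR: "X \<in> R \<Longrightarrow> \<tau> (r *\<^sub>R X) = r * \<tau> X"
  using state unfolding state_def linear_on_algebra_def by (metis scalar_of_real_compose)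

lemma trace_diff: "X \<in> R \<Longrightarrow> Y \<in> R \<Longrightarrow> \<tau> (X - Y) = \<tau> X - \<tau> Y"
  using trace_add[of "X - Y" Y] by (simp add: diff_in)

lemma trace_sum:
  assumes "finite I" "\<And>i. i \<in> I \<Longrightarrow> X i \<in> R"
  shows "(\<Sum>i\<in>I. X i) \<in> R \<and> \<tau> (\<Sum>i\<in>I. X i) = (\<Sum>i\<in>I. \<tau> (X i))"
  using assms
  by (induction I rule: finite_induct)
     (use scaleR_in[OF id_in, of 0] trace_scaleR[OF id_in, of 0] in \<open>auto simp: trace_add add_in\<close>)

lemma trace_nonneg: "X \<in> R \<Longrightarrow> positive_op X \<Longrightarrow> Re (\<tau> X) \<ge> 0"
  using state by (simp add: state_def complex_nonneg_Reals_iff)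

text \<open>With S = sqrt(q)(B), the trace property gives \<tau>(S S X) = \<tau>(S X S), and S X S
  is positive although q(B) X need not be.\<close>

lemma trace_cfc_compose_nonneg:
  assumes B: "self_adjoint_operator B K" "B \<in> R"
    and q: "continuous_on K q" "\<And>t. t \<in> K \<Longrightarrow> q t \<ge> 0"
    and X: "X \<in> R" "positive_op X"
  shows "Re (\<tau> (cfc q B o\<^sub>L X)) \<ge> 0"
proof -
  interpret B: self_adjoint_operator B K by fact
  define S where "S = cfc (\<lambda>t. sqrt (q t)) B"
  have root: "continuous_on K (\<lambda>t. sqrt (q t))"
    by (intro continuous_intros q)
  have S: "S \<in> R" "self_adjoint S"
    unfolding S_def using B root by (auto intro: cfc_in B.self_adjoint_cfc)
  have "cfc q B = cfc (\<lambda>t. sqrt (q t) * sqrt (q t)) B"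
    using B.real_spectrum_subset q(2) by (intro cfc_cong) (simp add: subset_iff)
  also have "\<dots> = S o\<^sub>L S"
    unfolding S_def by (rule B.cfc_mult[OF root root])
  finally have "\<tau> (cfc q B o\<^sub>L X) = \<tau> (S o\<^sub>L (S o\<^sub>L X))"
    by (simp only: blinfun_compose_assoc)
  also have "\<dots> = \<tau> ((S o\<^sub>L X) o\<^sub>L S)"
    using tracial S X unfolding tracial_def by (blast intro: compose_in)
  finally show ?thesis
    using S X by (simp add: trace_nonneg compose_in positive_op_conjugate)
qed

text \<open>Stated without the map: all that is asked of \<open>G\<close> is that it dominates l(B)
  for every affine l \<le> g.\<close>

lemma trace_convex_le:
  assumes B: "self_adjoint_operator B {a..b}" "B \<in> R" and G: "G \<in> R"
    and g: "continuous_on {a..b} g" "convex_on {a..b} g"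
    and minorant: "\<And>c d. (\<And>t. t \<in> {a..b} \<Longrightarrow> c * t + d \<le> g t)
      \<Longrightarrow> positive_op (G - cfc (\<lambda>t. c * t + d) B)"
  shows "Re (\<tau> (cfc g B)) \<le> Re (\<tau> G)"
proof (rule field_le_epsilon)
  fix e :: real assume e: "e > 0"
  interpret B: self_adjoint_operator B "{a..b}" by fact
  obtain I :: "(real \<times> real) set" where I: "finite I"
    "\<And>c d t. (c, d) \<in> I \<Longrightarrow> t \<in> {a..b} \<Longrightarrow> c * t + d \<le> g t"
    "\<And>t. t \<in> {a..b} \<Longrightarrow> \<exists>(c, d)\<in>I. g t - e < c * t + d"
    using convex_finite_affine_minorants[OF g e] by blast
  define l where "l = (\<lambda>(i :: real \<times> real) t. fst i * t + snd i)"
  \<comment> \<open>Positive exactly where l_i > g - e, hence continuous weights whose sum is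
    positive on all of [a,b].\<close>
  define r where "r i t = max 0 (l i t - g t + e)" for i t
  define q where "q i t = r i t / (\<Sum>j\<in>I. r j t)" for i t
  have sum_pos: "(\<Sum>j\<in>I. r j t) > 0" if t: "t \<in> {a..b}" for t
  proof -
    obtain i where "i \<in> I" "g t - e < l i t" using I(3)[OF t] by (auto simp: l_def)
    then show ?thesis
      by (intro sum_pos2[OF I(1)]) (auto simp: r_def)
  qed
  have l_cont: "continuous_on {a..b} (l i)" for i
    unfolding l_def by (intro continuous_intros)
  have r_cont: "continuous_on {a..b} (r i)" for i
    unfolding r_def by (intro continuous_intros l_cont g)
  have q_cont: "continuous_on {a..b} (q i)" for i
    unfolding q_def using sum_pos
    by (intro continuous_intros r_cont) (auto simp: less_imp_neq[symmetric])
  have q_nonneg: "q i t \<ge> 0" for i t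
    unfolding q_def r_def by (intro divide_nonneg_nonneg sum_nonneg) auto
  have q_sum: "(\<Sum>i\<in>I. q i t) = 1" if "t \<in> {a..b}" for t
    using sum_pos[OF that] by (simp add: q_def flip: sum_divide_distrib)
  have mix: "g t - e \<le> (\<Sum>i\<in>I. q i t * l i t)" if t: "t \<in> {a..b}" for t
  proof -
    \<comment> \<open>Where the second factor is negative, the weight vanishes.\<close>
    have "q i t * (l i t - g t + e) \<ge> 0" for i
    proof (cases "l i t - g t + e \<ge> 0")
      case True
      with q_nonneg show ?thesis by (intro mult_nonneg_nonneg)
    next
      case False
      then show ?thesis by (simp add: q_def r_def)
    qed
    then have "0 \<le> (\<Sum>i\<in>I. q i t * (l i t - g t + e))"
      by (intro sum_nonneg) auto
    also have "\<dots> = (\<Sum>i\<in>I. q i t * l i t) - (\<Sum>i\<in>I. q i t) * (g t - e)"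
      unfolding sum_distrib_right sum_subtractf[symmetric] by (simp add: algebra_simps)
    finally show ?thesis by (simp add: q_sum[OF t])
  qed
  define L where "L = (\<lambda>t. \<Sum>i\<in>I. q i t * l i t)"
  have L_cont: "continuous_on {a..b} L"
    unfolding L_def by (intro continuous_intros q_cont l_cont)
  have "(\<Sum>i\<in>I. cfc (q i) B) = id_blinfun"
  proof -
    have "(\<Sum>i\<in>I. cfc (q i) B) = cfc (\<lambda>t. \<Sum>i\<in>I. q i t) B"
      by (rule B.cfc_sum[symmetric]) (auto intro: I q_cont)
    also have "\<dots> = cfc (\<lambda>t. 1) B"
      using q_sum B.real_spectrum_subset by (intro cfc_cong) auto
    finally show ?thesis by (simp add: B.cfc_const)
  qed
  moreover have "(\<Sum>i\<in>I. cfc (q i) B o\<^sub>L cfc (l i) B) = cfc L B"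
    unfolding L_def
    by (subst B.cfc_sum) (auto intro!: I continuous_intros q_cont l_cont simp: B.cfc_mult q_cont l_cont)
  \<comment> \<open>The weights q_i(B) sum to the identity, so \<open>G\<close> comes out whole, and
    the products q_i(B) l_i(B) add up to L(B).\<close>
  ultimately have "(\<Sum>i\<in>I. cfc (q i) B o\<^sub>L (G - cfc (l i) B)) = G - cfc L B"
    by (simp add: blinfun_compose_simps sum_subtractf
        flip: bounded_bilinear.sum_left[OF bounded_bilinear_blinfun_compose])
  moreover have in_R: "cfc f B \<in> R" if "continuous_on {a..b} f" for f
    using B that by (intro cfc_in)
  moreover have "Re (\<tau> (\<Sum>i\<in>I. cfc (q i) B o\<^sub>L (G - cfc (l i) B))) \<ge> 0"
  proof -
    have "Re (\<tau> (cfc (q i) B o\<^sub>L (G - cfc (l i) B))) \<ge> 0" if "i \<in> I" for i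
    proof (rule trace_cfc_compose_nonneg[OF B q_cont q_nonneg])
      show "G - cfc (l i) B \<in> R" by (intro diff_in G in_R l_cont)
      show "positive_op (G - cfc (l i) B)"
        unfolding l_def using I(2)[of "fst i" "snd i"] that by (intro minorant) auto
    qed
    moreover have "\<tau> (\<Sum>i\<in>I. cfc (q i) B o\<^sub>L (G - cfc (l i) B))
        = (\<Sum>i\<in>I. \<tau> (cfc (q i) B o\<^sub>L (G - cfc (l i) B)))"
      using trace_sum[OF I(1), of "\<lambda>i. cfc (q i) B o\<^sub>L (G - cfc (l i) B)"]
      by (auto intro!: compose_in diff_in G in_R q_cont l_cont)
    ultimately show ?thesis by (simp add: sum_nonneg)
  qed
  ultimately have 1: "Re (\<tau> (cfc L B)) \<le> Re (\<tau> G)"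
    by (simp add: trace_diff G L_cont)
  \<comment> \<open>The pointwise bound L \<ge> g - e becomes an operator inequality; since \<tau>
    is 1 at the identity, the trace loses at most e.\<close>
  have "positive_op (cfc (\<lambda>t. L t - g t + e) B)"
    using mix by (intro B.positive_op_cfc continuous_intros L_cont g) (auto simp: L_def algebra_simps)
  also have "cfc (\<lambda>t. L t - g t + e) B = cfc L B - cfc g B + e *\<^sub>R id_blinfun"
    by (simp add: B.cfc_add B.cfc_diff B.cfc_const L_cont g continuous_intros)
  finally have "Re (\<tau> (cfc L B - cfc g B + e *\<^sub>R id_blinfun)) \<ge> 0"
    by (intro trace_nonneg add_in diff_in scaleR_in id_in in_R L_cont g)
  moreover have "\<tau> id_blinfun = 1"
    using state by (simp add: state_def)
  ultimately have "Re (\<tau> (cfc g B)) \<le> Re (\<tau> (cfc L B)) + e"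
    by (simp add: trace_add trace_diff trace_scaleR diff_in scaleR_in id_in in_R L_cont g)
  with 1 show "Re (\<tau> (cfc g B)) \<le> Re (\<tau> G) + e" by simp
qed

end

text \<open>Positivity of f gives sqrt(f^2) = f, so the modulus of f(A) is f(A) itself, and the
  nested calculi collapse to log f at A.\<close>

lemma (in self_adjoint_operator) fuglede_kadison_det_cfc:
  assumes f: "continuous_on K f" and pos: "\<And>t. t \<in> K \<Longrightarrow> f t > 0"
  shows "fuglede_kadison_det \<tau> (cfc f A) = exp (Re (\<tau> (cfc (\<lambda>t. ln (f t)) A)))"
proof -
  have ff: "continuous_on K (\<lambda>t. f t * f t)"
    by (intro continuous_intros f)
  have "cfc sqrt (adj (cfc f A) o\<^sub>L cfc f A) = cfc sqrt (cfc (\<lambda>t. f t * f t) A)"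
    by (simp only: adj_self_adjoint self_adjoint_cfc f cfc_mult)
  also have "\<dots> = cfc (\<lambda>t. sqrt (f t * f t)) A"
    by (intro cfc_compose ff continuous_on_real_sqrt continuous_on_id)
  also have "\<dots> = cfc f A"
    using real_spectrum_subset pos by (intro cfc_cong) (auto simp: less_imp_le subset_iff)
  finally show ?thesis
    using pos unfolding fuglede_kadison_det_def
    by (subst cfc_compose[symmetric, OF f])
       (auto intro!: continuous_on_ln continuous_on_id simp: less_imp_neq[symmetric])
qed

section \<open>Positive maps\<close>

text \<open>Order bounds survive a unital positive map, and this recovers the spectrum from them:
  for t < a the operator B - t is coercive with constant a - t, for t > b so is t - B with constant
  t - b.\<close>

lemma real_spectrum_bounds:
  fixes B :: "'h::chilbert_space operator"
  assumes lower: "positive_op (B - a *\<^sub>R id_blinfun)" and upper: "positive_op (b *\<^sub>R id_blinfun - B)"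
  shows "real_spectrum B \<subseteq> {a..b}"
proof
  fix t assume t: "t \<in> real_spectrum B"
  have form: "a * (norm x)\<^sup>2 \<le> inner (B x) x" "inner (B x) x \<le> b * (norm x)\<^sup>2" for x
    using assms by (simp_all add: positive_op_iff blinfun.bilinear_simps inner_diff_left power2_norm_eq_inner)
  have "B - a *\<^sub>R id_blinfun \<in> bounded_operators"
    using lower by (simp add: positive_op_def)
  from bounded_operators_add[OF this bounded_operators_scaleR[OF bounded_operators_id, of a]]
  have B: "B \<in> bounded_operators" by simp
  have "\<not> t < a"
  proof
    assume "t < a"
    then have "invertible_op (B - t *\<^sub>R id_blinfun)"
      using form B
      by (intro coercive_invertible[where c = "a - t"])
         (simp_all add: bounded_operators_diff bounded_operators_scaleR bounded_operators_id
           blinfun.bilinear_simps inner_diff_left algebra_simps power2_norm_eq_inner)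
    with t show False by (simp add: real_spectrum_iff)
  qed
  moreover have "\<not> t > b"
  proof
    assume "t > b"
    then have "invertible_op (t *\<^sub>R id_blinfun - B)"
      using form B
      by (intro coercive_invertible[where c = "t - b"])
         (simp_all add: bounded_operators_diff bounded_operators_scaleR bounded_operators_id
           blinfun.bilinear_simps inner_diff_left algebra_simps power2_norm_eq_inner)
    moreover have "invertible_op ((-1) *\<^sub>R id_blinfun :: 'h operator)"
      unfolding invertible_op_def
      by (intro bexI[of _ "(-1) *\<^sub>R id_blinfun"] conjI bounded_operators_scaleR bounded_operators_id
          blinfun_eqI) (simp_all add: blinfun.bilinear_simps)
    ultimately have "invertible_op (((-1) *\<^sub>R id_blinfun) o\<^sub>L (t *\<^sub>R id_blinfun - B))"
      by (intro invertible_op_compose)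
    moreover have "((-1) *\<^sub>R id_blinfun) o\<^sub>L (t *\<^sub>R id_blinfun - B) = B - t *\<^sub>R id_blinfun"
      by (rule blinfun_eqI) (simp add: blinfun.bilinear_simps)
    ultimately show False using t by (simp add: real_spectrum_iff)
  qed
  ultimately show "t \<in> {a..b}" by auto
qed

theorem theorem4p15:
  fixes R :: "'h::chilbert_space operator set"
    and \<tau> :: "'h operator \<Rightarrow> complex"
    and \<Phi> :: "'h operator \<Rightarrow> 'h operator"
    and f :: "real \<Rightarrow> real"
    and a b :: real
    and A :: "'h operator"
  assumes "finite_von_neumann_algebra R"
    and "faithful_normal_tracial_state R \<tau>"
    and "unital_positive_map R \<Phi>"
    and "trace_preserving R \<tau> \<Phi>"
    and "continuous_on {a..b} f"
    and "\<And>t. t \<in> {a..b} \<Longrightarrow> f t > 0"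
    and "convex_on {a..b} (\<lambda>t. ln (f t))"
    and "A \<in> R"
    and "positive_op A"
    and "spectrum A \<subseteq> complex_of_real ` {a..b}"
  shows "fuglede_kadison_det \<tau> (cfc f (\<Phi> A)) \<le> fuglede_kadison_det \<tau> (cfc f A)"
proof -
  interpret tracial_von_neumann_algebra R \<tau>
    using assms(1,2)
    by unfold_locales (auto simp: finite_von_neumann_algebra_def faithful_normal_tracial_state_def)
  note f = assms(5,6) and A = assms(8)
  have \<Phi>_in: "\<Phi> X \<in> R" and \<Phi>_pos: "positive_op X \<Longrightarrow> positive_op (\<Phi> X)" if "X \<in> R" for X
    using assms(3) that by (auto simp: unital_positive_map_def)
  have \<Phi>_add: "\<Phi> (X + Y) = \<Phi> X + \<Phi> Y" if "X \<in> R" "Y \<in> R" for X Y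
    using assms(3) that by (simp add: unital_positive_map_def linear_on_algebra_def)
  have \<Phi>_scaleR: "\<Phi> (r *\<^sub>R X) = r *\<^sub>R \<Phi> X" if "X \<in> R" for r X
    using assms(3) that unfolding unital_positive_map_def linear_on_algebra_def
    by (metis scalar_of_real_compose)
  have \<Phi>_diff: "\<Phi> (X - Y) = \<Phi> X - \<Phi> Y" if "X \<in> R" "Y \<in> R" for X Y
    using \<Phi>_add[of "X - Y" Y] that by (simp add: diff_in)
  have \<Phi>_id: "\<Phi> id_blinfun = id_blinfun"
    using assms(3) by (simp add: unital_positive_map_def)
  interpret A: self_adjoint_operator A "{a..b}"
    using assms(9,10) by unfold_locales (auto simp: positive_op_iff real_spectrum_def)
  define g where "g = (\<lambda>t. ln (f t))"
  have g: "continuous_on {a..b} g"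
    unfolding g_def using f by (intro continuous_on_ln) (auto simp: less_imp_neq[symmetric])
  \<comment> \<open>The inclusion of the spectrum in [a,b] is rewritten as a \<le> A \<le> b, the
    form that the positive map can transport.\<close>
  have "positive_op (cfc (\<lambda>t. t - a) A)" "positive_op (cfc (\<lambda>t. b - t) A)"
    by (auto intro!: A.positive_op_cfc continuous_intros)
  then have "positive_op (A - a *\<^sub>R id_blinfun)" "positive_op (b *\<^sub>R id_blinfun - A)"
    by (simp_all add: A.cfc_diff A.cfc_const A.cfc_id continuous_intros)
  then have "positive_op (\<Phi> (A - a *\<^sub>R id_blinfun))" "positive_op (\<Phi> (b *\<^sub>R id_blinfun - A))"
    by (auto intro!: \<Phi>_pos diff_in scaleR_in id_in A)
  then have "real_spectrum (\<Phi> A) \<subseteq> {a..b}"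
    by (intro real_spectrum_bounds) (simp_all add: \<Phi>_diff \<Phi>_scaleR \<Phi>_id A scaleR_in id_in)
  moreover have "self_adjoint (\<Phi> A)"
    using \<Phi>_pos[OF A assms(9)] by (simp add: positive_op_iff)
  ultimately have B: "self_adjoint_operator (\<Phi> A) {a..b}"
    by unfold_locales auto
  then interpret B: self_adjoint_operator "\<Phi> A" "{a..b}" .
  have gA: "cfc g A \<in> R"
    by (rule cfc_in[OF A.self_adjoint_operator_axioms g A])
  have "Re (\<tau> (cfc g (\<Phi> A))) \<le> Re (\<tau> (\<Phi> (cfc g A)))"
  proof (rule trace_convex_le[OF B \<Phi>_in[OF A] \<Phi>_in[OF gA] g])
    show "convex_on {a..b} g"
      unfolding g_def by fact
    fix c d assume le: "\<And>t. t \<in> {a..b} \<Longrightarrow> c * t + d \<le> g t"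
    have "positive_op (cfc (\<lambda>t. g t - (c * t + d)) A)"
      using le by (intro A.positive_op_cfc continuous_intros g) auto
    \<comment> \<open>The affine part is spelled out in \<open>A\<close> and the identity so that
      linearity and unitality turn its image into c \<Phi>(A) + d, the same affine function of
      \<open>\<Phi> A\<close>.\<close>
    also have "cfc (\<lambda>t. g t - (c * t + d)) A = cfc g A - (c *\<^sub>R A + d *\<^sub>R id_blinfun)"
      by (simp add: A.cfc_diff A.cfc_add A.cfc_scaleR A.cfc_const A.cfc_id continuous_intros g)
    finally have "positive_op (\<Phi> (cfc g A - (c *\<^sub>R A + d *\<^sub>R id_blinfun)))"
      by (intro \<Phi>_pos diff_in add_in scaleR_in id_in A gA)
    then show "positive_op (\<Phi> (cfc g A) - cfc (\<lambda>t. c * t + d) (\<Phi> A))"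
      by (simp add: \<Phi>_diff \<Phi>_add \<Phi>_scaleR \<Phi>_id A gA add_in scaleR_in id_in
          B.cfc_add B.cfc_scaleR B.cfc_const B.cfc_id continuous_intros)
  qed
  also have "\<tau> (\<Phi> (cfc g A)) = \<tau> (cfc g A)"
    using assms(4) gA by (simp add: trace_preserving_def)
  finally show ?thesis
    unfolding g_def
    by (subst A.fuglede_kadison_det_cfc, use f in blast, use f in blast)
       (subst B.fuglede_kadison_det_cfc, use f in blast, use f in blast, simp)
qed

end
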